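(* Let $r>0$, let $U \subseteq \mathbb{R}^n$ be open, $m \in \mathbb{N}$, and let $g_1,\ldots,g_m \colon U \to \mathbb{R}$ be continuous and $C^{1,1}$-submersions on their zero sets. Assume that the set $$\Omega = \{ x \in U \mid g_1(x) \leq 0,\ldots, g_m(x) \leq 0\}$$ is closed in $\mathbb{R}^n$ and connected. For $x \in \Omega$ let $\mathcal{A}(x)=\{ i \in \{1,\ldots,m\} \mid g_i(x) =0\}$ and $\mathcal{C}(x)=\{ h \in \mathbb{R}^n \mid g'_j(x) h \leq 0 \text{ for all } j \in \mathcal{A}(x)\}$. For $x\in\partial\Omega$, $i \in \mathcal{A}(x)$ and $h \in \mathbb{R}^n$ consider the inequality $$\liminf_{t\to 0,\,t>0}\frac{g'_i(x+th)h}{t} \geq \frac{1}{r}\,\|g_i'(x)\|\cdot \|h\|^2. \qquad ( * )$$ (i) $\Omega$ is $r$-convex if for every $x \in \partial \Omega$ the interior of $\mathcal{C}(x)$ is non-empty and there exists $i \in \mathcal{A}(x)$ such that $( * )$ holds whenever $h \in \mathcal{C}(x)\cap \ker g'_i(x)$. (ii) $\Omega$ is $r$-convex if $( * )$ holds for every $x \in \partial \Omega$, every $i \in \mathcal{A}(x)$, and all $h \in \mathcal{C}(x)\cap \ker g'_i(x)$. (iii) If $\Omega$ is $r$-convex, $x \in \partial \Omega$, and the derivatives $g_i'(x)$, $i \in \mathcal{A}(x)$, are linearly independent, then $( * )$ holds for every $i \in \mathcal{A}(x)$ and all $h \in \mathcal{C}(x)\cap \ker g'_i(x)$.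
   Context: $\mathbb{R}^n$ carries the Euclidean inner product and norm $\|\cdot\|$ (with induced operator norm on linear maps); $\partial\Omega$ is the boundary of $\Omega$ in $\mathbb{R}^n$; $\mathbb{N}=\{1,2,\ldots\}$. For $r>0$, a set $\Omega \subseteq \mathbb{R}^n$ is $r$-convex if for all $x,y \in \Omega$ the intersection of all closed balls of radius $r$ (centered at any $c \in \mathbb{R}^n$) that contain both $x$ and $y$ is a subset of $\Omega$; this intersection is considered equal to $\mathbb{R}^n$ if no such ball exists. A map is of class $C^{1,1}$ if it is of class $C^1$ and its derivative is Lipschitz continuous. A map $f\colon U \to \mathbb{R}$ on an open set $U \subseteq \mathbb{R}^n$ is a $C^{1,1}$-submersion on its zero set if, for every zero $x$ of $f$, $f$ is of class $C^{1,1}$ on a neighborhood of $x$ and $f'(x)$ is surjective.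
   Formalization: Parts (i) and (ii) are stated for n ≥ 2 only; for n = 1 they fail, e.g. r = 1, U = ℝ, g_1(x) = x(x−100), Ω = [0,100], where (∗) holds trivially but no ball of radius 1 contains both 0 and 100, so Ω is not 1-convex. *)

theory Defs
  imports "HOL-Analysis.Analysis"
begin

text \<open>If no ball of radius \<open>r\<close> contains both points, the intersection below is that of the
  empty family, which is \<open>UNIV\<close>.\<close>

definition r_convex :: "real \<Rightarrow> 'a::metric_space set \<Rightarrow> bool" where
  "r_convex r S \<longleftrightarrow>
     (\<forall>x\<in>S. \<forall>y\<in>S. \<Inter>{cball c r | c. x \<in> cball c r \<and> y \<in> cball c r} \<subseteq> S)"

text \<open>The derivative as a bounded linear map, so that \<open>norm\<close> is the operator norm. It is
  meaningful only at points where \<open>f\<close> is differentiable.\<close>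

definition fderiv :: "('a::real_normed_vector \<Rightarrow> 'b::real_normed_vector) \<Rightarrow> 'a \<Rightarrow> 'a \<Rightarrow>\<^sub>L 'b" where
  "fderiv f x = Blinfun (frechet_derivative f (at x))"

definition C11_on :: "'a::real_normed_vector set \<Rightarrow> ('a \<Rightarrow> 'b::real_normed_vector) \<Rightarrow> bool" where
  "C11_on V f \<longleftrightarrow>
     (\<forall>x\<in>V. f differentiable (at x)) \<and> continuous_on V (fderiv f) \<and>
     (\<exists>L. L-lipschitz_on V (fderiv f))"

text \<open>Functions on \<open>U\<close> are total functions whose values outside \<open>U\<close> play no role.\<close>

definition C11_submersion_on_zero_set :: "'a::real_normed_vector set \<Rightarrow> ('a \<Rightarrow> real) \<Rightarrow> bool" where
  "C11_submersion_on_zero_set U f \<longleftrightarrow>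
     (\<forall>x\<in>U. f x = 0 \<longrightarrow>
        (\<exists>V. open V \<and> x \<in> V \<and> V \<subseteq> U \<and> C11_on V f) \<and> surj (blinfun_apply (fderiv f x)))"

definition feasible_set :: "'a set \<Rightarrow> nat \<Rightarrow> (nat \<Rightarrow> 'a \<Rightarrow> real) \<Rightarrow> 'a set" where
  "feasible_set U m g = {x \<in> U. \<forall>i\<in>{1..m}. g i x \<le> 0}"

definition active :: "nat \<Rightarrow> (nat \<Rightarrow> 'a \<Rightarrow> real) \<Rightarrow> 'a \<Rightarrow> nat set" where
  "active m g x = {i \<in> {1..m}. g i x = 0}"

definition lin_cone :: "nat \<Rightarrow> (nat \<Rightarrow> 'a::real_normed_vector \<Rightarrow> real) \<Rightarrow> 'a \<Rightarrow> 'a set" where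
  "lin_cone m g x = {h. \<forall>j\<in>active m g x. fderiv (g j) x h \<le> 0}"

definition ker :: "('a::real_normed_vector \<Rightarrow>\<^sub>L 'b::real_normed_vector) \<Rightarrow> 'a set" where
  "ker F = {h. F h = 0}"

text \<open>The lower limit is taken in the extended reals.\<close>

definition curvature_ineq :: "real \<Rightarrow> ('a::real_normed_vector \<Rightarrow> real) \<Rightarrow> 'a \<Rightarrow> 'a \<Rightarrow> bool" where
  "curvature_ineq r f x h \<longleftrightarrow>
     Liminf (at_right 0) (\<lambda>t::real. ereal (fderiv f (x + t *\<^sub>R h) h / t))
       \<ge> ereal (1 / r * norm (fderiv f x) * (norm h)\<^sup>2)"

text \<open>Linear independence of a family rather than of its set of values: a repeated member makes
  the family dependent.\<close>

definition lin_indep_family :: "'i set \<Rightarrow> ('i \<Rightarrow> 'v::real_vector) \<Rightarrow> bool" where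
  "lin_indep_family I v \<longleftrightarrow> (\<forall>c. (\<Sum>i\<in>I. c i *\<^sub>R v i) = 0 \<longrightarrow> (\<forall>i\<in>I. c i = 0))"

end

theory Submission
  imports Defs
begin

text \<open>
  The proof passes between two ways of saying that the boundary of a set is curved with radius at
  most \<open>r\<close>: through tangent balls, and through second-order behaviour of the constraints.

  \<^emph>\<open>From local to global.\<close> Suppose that near each of its boundary points \<open>p\<close> the set lies in a
  closed ball of radius \<open>R\<close> with \<open>p\<close> on its sphere, for every \<open>R > r\<close>. Then neither a line
  segment nor a planar disc of radius larger than \<open>r\<close> can touch the boundary from inside: two short
  steps in opposite tangent directions would leave the ball. Everything global comes from
  this exclusion. If the interior is connected, the set of interior points visible from a given one
  is open and closed, so the interior is convex (\<open>convex_interior_if_supported\<close>). Over a chord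
  with interior endpoints, the cap below a circular arc of radius \<open>\<rho> > r\<close> is filled by translating
  the arc outward from the chord; a first contact with the boundary would be a forbidden touching
  disc (\<open>cap_in_interior\<close>). Letting \<open>\<rho>\<close> tend to \<open>r\<close>, the caps fill the intersection of the balls
  of radius \<open>r\<close> through the two endpoints. If two interior points have a distance above \<open>2 r\<close>, the caps
  contain a ball of radius above \<open>r\<close>, and by the same exclusion it can be inflated without ever
  meeting the boundary. This gives \<open>r_convex_if_locally_supported\<close>.

  \<^emph>\<open>Sufficiency of the inequality.\<close> Integrating the curvature inequality along a tangent direction
  yields the local tangent ball; the Lipschitz condition transfers the estimate to nearby
  directions, and compactness of the unit sphere makes it uniform
  (\<open>supported_at_if_curvature_ineq\<close>). The inequality for a single constraint
  does not see whether the set has an interior at all: an arc of a circle lies in a disc as well.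
  What is needed is a direction in which all active constraints decrease strictly. It makes the set
  locally a union of parallel segments that enter the interior, so that the interior inherits
  connectedness. If the cone of linearized constraints has interior points, each of them is such a
  direction. If instead
  the inequality holds for all active constraints, then the tangent balls of all of them show that
  \<open>y - x\<close> is such a direction for every feasible \<open>y\<close> close to \<open>x\<close>; only isolated points lack
  such \<open>y\<close>, and a connected set with an isolated point is a singleton.

  \<^emph>\<open>Necessity.\<close> An \<open>r\<close>-convex set that satisfies a smooth constraint lies, as a whole, in the
  tangent ball of radius \<open>r\<close> at each of its points where the constraint is active
  (\<open>r_convex_supporting_ball\<close>). Writing this for \<open>x\<close> and for a second point
  of the same hypersurface and adding the two inequalities bounds the rotation of the normal from
  below; dividing by the squared distance gives the curvature inequality. The second point must be
  feasible, which holds along directions in which the remaining active constraints decrease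
  strictly. Linear independence makes every direction of the cone in the kernel a limit of such
  directions, and the inequality survives the limit (\<open>curvature_ineq_limit\<close>).
\<close>

section \<open>Sets that lie locally in tangent balls\<close>

definition supported_at :: "real \<Rightarrow> 'a::real_inner set \<Rightarrow> 'a \<Rightarrow> bool" where
  "supported_at R S p \<longleftrightarrow>
     (\<exists>\<nu> \<delta>. norm \<nu> = 1 \<and> \<delta> > 0 \<and> S \<inter> ball p \<delta> \<subseteq> cball (p - R *\<^sub>R \<nu>) R)"

lemma mem_tangent_cball_iff:
  fixes p v \<nu> :: "'a::real_inner"
  assumes "norm \<nu> = 1" "R \<ge> 0"
  shows "p + v \<in> cball (p - R *\<^sub>R \<nu>) R \<longleftrightarrow> (norm v)\<^sup>2 + 2 * R * (\<nu> \<bullet> v) \<le> 0"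
proof -
  have "dist (p - R *\<^sub>R \<nu>) (p + v) = norm (v + R *\<^sub>R \<nu>)"
    by (subst dist_commute) (simp add: dist_norm algebra_simps)
  then have "p + v \<in> cball (p - R *\<^sub>R \<nu>) R \<longleftrightarrow> norm (v + R *\<^sub>R \<nu>) \<le> R"
    by simp
  also have "\<dots> \<longleftrightarrow> (norm (v + R *\<^sub>R \<nu>))\<^sup>2 \<le> R\<^sup>2"
    using assms(2) by (simp add: abs_le_square_iff[symmetric])
  also have "(norm (v + R *\<^sub>R \<nu>))\<^sup>2 = (norm v)\<^sup>2 + 2 * R * (\<nu> \<bullet> v) + R\<^sup>2"
    using assms(1) unfolding power2_norm_eq_inner
    by (simp add: inner_add_left inner_add_right inner_commute norm_eq_1 power2_eq_square)
  finally show ?thesis by simp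
qed

lemma supported_atE:
  assumes "supported_at R S p" "R \<ge> 0"
  obtains \<nu> \<delta> where "norm \<nu> = 1" "\<delta> > 0"
    "\<And>v. p + v \<in> S \<Longrightarrow> norm v < \<delta> \<Longrightarrow> (norm v)\<^sup>2 + 2 * R * (\<nu> \<bullet> v) \<le> 0"
proof -
  obtain \<nu> \<delta> where n: "norm \<nu> = 1" "\<delta> > 0" "S \<inter> ball p \<delta> \<subseteq> cball (p - R *\<^sub>R \<nu>) R"
    using assms unfolding supported_at_def by blast
  have "(norm v)\<^sup>2 + 2 * R * (\<nu> \<bullet> v) \<le> 0" if "p + v \<in> S" "norm v < \<delta>" for v
  proof -
    have "p + v \<in> S \<inter> ball p \<delta>" using that by (simp add: dist_norm)
    then show ?thesis using n mem_tangent_cball_iff assms(2) by blast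
  qed
  then show ?thesis using that n by blast
qed

text \<open>Adding the ball conditions for \<open>p + t w\<close> and \<open>p - t w\<close> cancels the linear term in \<open>\<nu>\<close> and
  leaves \<open>t\<^sup>2 \<parallel>w\<parallel>\<^sup>2 \<le> 0\<close>.\<close>

lemma no_segment_at_supported_point:
  assumes "supported_at R S p" "R \<ge> 0" "w \<noteq> 0" "\<eta> > 0"
    and "\<And>t. 0 < t \<Longrightarrow> t < \<eta> \<Longrightarrow> p + t *\<^sub>R w \<in> S \<and> p - t *\<^sub>R w \<in> S"
  shows False
proof -
  obtain \<nu> \<delta> where n: "norm \<nu> = 1" "\<delta> > 0"
    and s: "\<And>v. p + v \<in> S \<Longrightarrow> norm v < \<delta> \<Longrightarrow> (norm v)\<^sup>2 + 2 * R * (\<nu> \<bullet> v) \<le> 0"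
    using supported_atE[OF assms(1,2)] by blast
  define t where "t = min (\<eta> / 2) (\<delta> / (2 * norm w))"
  have nw: "norm w > 0" using assms(3) by simp
  have t: "0 < t" "t < \<eta>" using assms(4) n(2) nw by (auto simp: t_def min_less_iff_disj)
  have "t * norm w \<le> \<delta> / (2 * norm w) * norm w"
    using nw by (intro mult_right_mono) (auto simp: t_def)
  then have tw: "t * norm w < \<delta>" using nw n(2) by simp
  have "(norm (t *\<^sub>R w))\<^sup>2 + 2 * R * (\<nu> \<bullet> (t *\<^sub>R w)) \<le> 0"
    using assms(5)[OF t] tw t by (intro s) auto
  moreover have "(norm (- (t *\<^sub>R w)))\<^sup>2 + 2 * R * (\<nu> \<bullet> (- (t *\<^sub>R w))) \<le> 0"
    using assms(5)[OF t] tw t by (intro s) auto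
  ultimately have "(norm (t *\<^sub>R w))\<^sup>2 \<le> 0"
    unfolding norm_minus_cancel inner_minus_right by linarith
  then show False using t assms(3) by simp
qed

text \<open>The planar analogue for curved contact. The points \<open>p \<plusminus> t e + s n\<close> with \<open>t\<^sup>2 + s\<^sup>2 = 2 \<rho> s\<close> lie on
  the circle of radius \<open>\<rho>\<close> through \<open>p\<close>, and adding their two ball conditions leaves
  \<open>\<rho> s \<le> R s\<close>.\<close>

lemma no_larger_disc_at_supported_point:
  assumes "supported_at R S p" "0 \<le> R" "R < \<rho>" "norm n = 1" "norm e = 1" "e \<bullet> n = 0" "\<eta> > 0"
    and disc: "\<And>t s. t\<^sup>2 + s\<^sup>2 \<le> 2 * \<rho> * s \<Longrightarrow> \<bar>t\<bar> < \<eta> \<Longrightarrow> \<bar>s\<bar> < \<eta> \<Longrightarrow> p + (t *\<^sub>R e + s *\<^sub>R n) \<in> S"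
  shows False
proof -
  obtain \<nu> \<delta> where n: "norm \<nu> = 1" "\<delta> > 0"
    and s: "\<And>v. p + v \<in> S \<Longrightarrow> norm v < \<delta> \<Longrightarrow> (norm v)\<^sup>2 + 2 * R * (\<nu> \<bullet> v) \<le> 0"
    using supported_atE[OF assms(1,2)] by blast
  have \<rho>: "\<rho> > 0" using assms by simp
  obtain s where s0: "0 < s" "s < min (min \<eta> \<rho>) (min (\<eta>\<^sup>2 / (2 * \<rho>)) (\<delta>\<^sup>2 / (2 * \<rho>)))"
    using dense[of 0 "min (min \<eta> \<rho>) (min (\<eta>\<^sup>2 / (2 * \<rho>)) (\<delta>\<^sup>2 / (2 * \<rho>)))"] \<rho> assms(7) n(2) by auto
  then have s1: "s < \<eta>" "s < \<rho>" "2 * \<rho> * s < \<eta>\<^sup>2" "2 * \<rho> * s < \<delta>\<^sup>2"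
    using \<rho> by (auto simp: field_simps)
  define t where "t = sqrt (2 * \<rho> * s - s\<^sup>2)"
  have "s * s \<le> 2 * \<rho> * s" using s0(1) s1(2) \<rho> by (intro mult_right_mono) auto
  then have t2: "t\<^sup>2 = 2 * \<rho> * s - s\<^sup>2" by (simp add: t_def power2_eq_square)
  have "t\<^sup>2 < \<eta>\<^sup>2" using t2 s1(3) s0(1) by (smt (verit) zero_le_power2)
  then have t\<eta>: "\<bar>t\<bar> < \<eta>" using assms(7) by (metis abs_of_pos linorder_not_less abs_le_square_iff)
  have ee: "e \<bullet> e = 1" "n \<bullet> n = 1" "n \<bullet> e = 0" using assms by (auto simp: norm_eq_1 inner_commute)
  have nv: "(norm (\<tau> *\<^sub>R e + s *\<^sub>R n))\<^sup>2 = 2 * \<rho> * s" if "\<tau>\<^sup>2 = t\<^sup>2" for \<tau>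
    using that t2 ee assms(6) unfolding power2_norm_eq_inner
    by (simp add: inner_add_left inner_add_right power2_eq_square)
  have nv': "norm (\<tau> *\<^sub>R e + s *\<^sub>R n) < \<delta>" if "\<tau>\<^sup>2 = t\<^sup>2" for \<tau>
    using nv[OF that] s1(4) n(2) by (metis less_eq_real_def power2_less_imp_less)
  have key: "2 * \<rho> * s + 2 * R * (\<nu> \<bullet> (\<tau> *\<^sub>R e + s *\<^sub>R n)) \<le> 0" if "\<tau>\<^sup>2 = t\<^sup>2" for \<tau>
  proof -
    have "\<bar>\<tau>\<bar> = \<bar>t\<bar>" using that by (simp add: power2_eq_iff abs_eq_iff)
    then have "p + (\<tau> *\<^sub>R e + s *\<^sub>R n) \<in> S"
      using disc[of \<tau> s] t2 that t\<eta> s1(1) s0(1) by auto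
    then show ?thesis using s[of "\<tau> *\<^sub>R e + s *\<^sub>R n"] nv[OF that] nv'[OF that] by simp
  qed
  have "2 * \<rho> * s + 2 * R * (s * (\<nu> \<bullet> n)) \<le> 0"
    using key[of t] key[of "-t"] by (simp add: inner_add_right algebra_simps)
  moreover have "s * (\<nu> \<bullet> n) \<ge> s * (- 1)"
    using Cauchy_Schwarz_ineq2[of \<nu> n] n(1) assms(4) s0(1) by (intro mult_left_mono) auto
  then have "R * (s * (\<nu> \<bullet> n)) \<ge> R * (- s)" using assms(2) by (intro mult_left_mono) auto
  ultimately have "\<rho> * s \<le> R * s" by simp
  then show False using s0(1) assms(3) by simp
qed

lemma closed_segment_in_interior:
  assumes "closed_segment a b \<subseteq> S" "a \<in> interior S" "b \<in> interior S"
    and sup: "\<And>p. p \<in> frontier S \<Longrightarrow> \<exists>R\<ge>0. supported_at R S p"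
  shows "closed_segment a b \<subseteq> interior S"
proof
  fix p assume p: "p \<in> closed_segment a b"
  show "p \<in> interior S"
  proof (rule ccontr)
    assume np: "p \<notin> interior S"
    then have "p \<in> frontier S" using p assms(1) closure_subset by (auto simp: frontier_def)
    then obtain R where R: "R \<ge> 0" "supported_at R S p" using sup by blast
    obtain u where u: "0 \<le> u" "u \<le> 1" "p = (1 - u) *\<^sub>R a + u *\<^sub>R b"
      using p by (auto simp: in_segment)
    have u01: "u \<noteq> 0" "u \<noteq> 1" using u np assms by auto
    have ab: "b - a \<noteq> 0" using np p assms by auto
    show False
    proof (rule no_segment_at_supported_point[OF R(2,1) ab, of "min u (1 - u)"])
      show "0 < min u (1 - u)" using u u01 by auto
      fix t assume t: "0 < t" "t < min u (1 - u)"
      have "p + t *\<^sub>R (b - a) = (1 - (u + t)) *\<^sub>R a + (u + t) *\<^sub>R b"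
        "p - t *\<^sub>R (b - a) = (1 - (u - t)) *\<^sub>R a + (u - t) *\<^sub>R b"
        by (auto simp: u(3) algebra_simps)
      moreover have "0 \<le> u + t" "u + t \<le> 1" "0 \<le> u - t" "u - t \<le> 1" using t u by auto
      ultimately have "p + t *\<^sub>R (b - a) \<in> closed_segment a b" "p - t *\<^sub>R (b - a) \<in> closed_segment a b"
        unfolding in_segment by blast+
      then show "p + t *\<^sub>R (b - a) \<in> S \<and> p - t *\<^sub>R (b - a) \<in> S" using assms(1) by blast
    qed
  qed
qed

text \<open>The points visible from \<open>a\<close> form a clopen subset of the interior: visibility is an open
  condition, and a limit of visible segments cannot touch the boundary.\<close>

lemma convex_interior_if_supported:
  fixes S :: "'a::euclidean_space set"
  assumes "closed S" "connected (interior S)"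
    and sup: "\<And>p. p \<in> frontier S \<Longrightarrow> \<exists>R\<ge>0. supported_at R S p"
  shows "convex (interior S)"
  unfolding convex_contains_segment
proof (intro ballI)
  fix a b assume a: "a \<in> interior S" and b: "b \<in> interior S"
  define V where "V = {y \<in> interior S. closed_segment a y \<subseteq> interior S}"
  have "open V"
    unfolding open_dist
  proof
    fix y assume y: "y \<in> V"
    then obtain \<epsilon> where \<epsilon>: "\<epsilon> > 0" "{z. infdist z (closed_segment a y) \<le> \<epsilon>} \<subseteq> interior S"
      using compact_in_open_separated[of "closed_segment a y" "interior S"] by (auto simp: V_def)
    show "\<exists>e>0. \<forall>z. dist z y < e \<longrightarrow> z \<in> V"
    proof (intro exI[of _ \<epsilon>] conjI allI impI \<epsilon>(1))
      fix z assume z: "dist z y < \<epsilon>"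
      have "w \<in> interior S" if w: "w \<in> closed_segment a z" for w
      proof -
        obtain u where u: "0 \<le> u" "u \<le> 1" "w = (1 - u) *\<^sub>R a + u *\<^sub>R z"
          using w by (auto simp: in_segment)
        define w' where "w' = (1 - u) *\<^sub>R a + u *\<^sub>R y"
        have "w - w' = u *\<^sub>R (z - y)" by (simp add: u w'_def algebra_simps)
        then have "dist w w' = u * dist z y" using u by (simp add: dist_norm)
        also have "\<dots> \<le> 1 * \<epsilon>" using u z by (intro mult_mono) auto
        finally have "infdist w (closed_segment a y) \<le> \<epsilon>"
          by (intro infdist_le2[of w']) (use u in \<open>auto simp: w'_def in_segment\<close>)
        then show ?thesis using \<epsilon>(2) by blast
      qed
      then show "z \<in> V" by (auto simp: V_def)
    qed
  qed
  moreover have "closedin (top_of_set (interior S)) V"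
    unfolding closedin_limpt
  proof (intro conjI allI impI)
    fix y assume y: "y islimpt V \<and> y \<in> interior S"
    then obtain f where f: "\<And>n. f n \<in> V" "f \<longlonglongrightarrow> y" by (auto simp: islimpt_sequential)
    have "closed_segment a y \<subseteq> S"
    proof
      fix w assume "w \<in> closed_segment a y"
      then obtain u where u: "0 \<le> u" "u \<le> 1" "w = (1 - u) *\<^sub>R a + u *\<^sub>R y"
        by (auto simp: in_segment)
      have "(\<lambda>n. (1 - u) *\<^sub>R a + u *\<^sub>R f n) \<longlonglongrightarrow> w"
        unfolding u(3) by (intro tendsto_intros f(2))
      moreover have "(1 - u) *\<^sub>R a + u *\<^sub>R f n \<in> S" for n
      proof -
        have "(1 - u) *\<^sub>R a + u *\<^sub>R f n \<in> closed_segment a (f n)" using u by (auto simp: in_segment)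
        then show ?thesis using f(1)[of n] interior_subset by (auto simp: V_def)
      qed
      ultimately show "w \<in> S" by (rule closed_sequentially[OF assms(1), rotated])
    qed
    then show "y \<in> V" using closed_segment_in_interior[OF _ a _ sup] y by (auto simp: V_def)
  qed (auto simp: V_def)
  ultimately have "V = {} \<or> V = interior S"
    using assms(2) unfolding connected_clopen
    by (metis (no_types, lifting) V_def mem_Collect_eq open_subset subsetI)
  moreover have "a \<in> V" using a by (simp add: V_def)
  ultimately show "closed_segment a b \<subseteq> interior S" using b by (auto simp: V_def)
qed

text \<open>The height at abscissa \<open>\<alpha>\<close> of the minor circular arc of radius \<open>\<rho>\<close> above its chord of
  half-length \<open>h\<close>, measured from the midpoint of the chord.\<close>

definition cap_height :: "real \<Rightarrow> real \<Rightarrow> real \<Rightarrow> real" where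
  "cap_height \<rho> h \<alpha> = sqrt (\<rho>\<^sup>2 - \<alpha>\<^sup>2) - sqrt (\<rho>\<^sup>2 - h\<^sup>2)"

lemma continuous_on_cap_height [continuous_intros]:
  "continuous_on A f \<Longrightarrow> continuous_on A (\<lambda>x. cap_height \<rho> h (f x))"
  unfolding cap_height_def by (intro continuous_intros)

lemma cap_height_end [simp]: "cap_height \<rho> h h = 0" "cap_height \<rho> h (- h) = 0"
  by (simp_all add: cap_height_def)

lemma in_closed_if_below:
  fixes u :: "'a::real_normed_vector"
  assumes "closed S" "\<tau>0 > 0" "\<And>\<tau>. 0 < \<tau> \<Longrightarrow> \<tau> < \<tau>0 \<Longrightarrow> p - \<tau> *\<^sub>R u \<in> S"
  shows "p \<in> S"
proof -
  have "((\<lambda>\<tau>. p - \<tau> *\<^sub>R u) \<longlongrightarrow> p - 0 *\<^sub>R u) (at_right 0)"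
    by (intro tendsto_intros)
  moreover have "eventually (\<lambda>\<tau>. p - \<tau> *\<^sub>R u \<in> S) (at_right 0)"
    using assms(2,3) by (auto simp: eventually_at_right_field)
  ultimately show ?thesis
    using Lim_in_closed_set[OF assms(1)] by (metis trivial_limit_at_right_real diff_zero scaleR_zero_left)
qed

text \<open>Translate the arc outward, starting below the chord. If some point of the cap is not interior,
  then among these there is one that maximizes the depth below the arc, and at it the translated
  arc bounds a disc of radius \<open>\<rho>\<close> that touches the boundary from inside. The contact point is
  neither on the chord nor on one of its endpoints, as these are interior points.\<close>

lemma cap_in_interior:
  fixes S :: "'a::euclidean_space set"
  assumes "closed S" "convex (interior S)"
    and sup: "\<And>p. p \<in> frontier S \<Longrightarrow> \<exists>R. 0 \<le> R \<and> R < \<rho> \<and> supported_at R S p"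
    and ab: "m - h *\<^sub>R e \<in> interior S" "m + h *\<^sub>R e \<in> interior S"
    and e: "norm e = 1" and u: "norm u = 1" and eu: "e \<bullet> u = 0"
    and h: "0 \<le> h" "h \<le> \<rho>" and \<rho>: "\<rho> > 0"
    and \<alpha>: "\<bar>\<alpha>\<bar> \<le> h" and \<beta>: "0 \<le> \<beta>" "\<beta> \<le> cap_height \<rho> h \<alpha>"
  shows "m + \<alpha> *\<^sub>R e + \<beta> *\<^sub>R u \<in> interior S"
proof (rule ccontr)
  assume nin: "m + \<alpha> *\<^sub>R e + \<beta> *\<^sub>R u \<notin> interior S"
  define X where "X = (\<lambda>(\<alpha>, \<beta>). m + \<alpha> *\<^sub>R e + \<beta> *\<^sub>R u)"
  define B where "B = {-h..h} \<times> {0..\<rho>} \<inter> {z. snd z \<le> cap_height \<rho> h (fst z)} \<inter> X -` (- interior S)"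
  have chord: "m + \<alpha> *\<^sub>R e \<in> interior S" if "\<bar>\<alpha>\<bar> \<le> h" for \<alpha>
  proof (cases "h = 0")
    case True then show ?thesis using that ab by simp
  next
    case False
    define w where "w = (\<alpha> + h) / (2 * h)"
    have w: "0 \<le> w" "w \<le> 1" using that h False by (auto simp: w_def field_simps abs_le_iff)
    have "(1 - w) *\<^sub>R (m - h *\<^sub>R e) + w *\<^sub>R (m + h *\<^sub>R e) = m + (w * (2 * h) - h) *\<^sub>R e"
      by (simp add: algebra_simps flip: scaleR_add_left)
    also have "w * (2 * h) - h = \<alpha>" using False by (simp add: w_def)
    finally show ?thesis using convexD_alt[OF assms(2) ab w] by simp
  qed
  have cap_le: "cap_height \<rho> h \<alpha> \<le> \<rho>" for \<alpha>
  proof -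
    have "sqrt (\<rho>\<^sup>2 - \<alpha>\<^sup>2) \<le> sqrt (\<rho>\<^sup>2)" by (intro real_sqrt_le_mono) simp
    moreover have "sqrt (\<rho>\<^sup>2 - h\<^sup>2) \<ge> 0" using h by (simp add: power_mono)
    ultimately show ?thesis using \<rho> unfolding cap_height_def by (simp del: real_sqrt_ge_0_iff)
  qed
  have contX: "continuous_on UNIV X" unfolding X_def case_prod_beta by (intro continuous_intros)
  have "compact B"
    unfolding B_def Int_assoc
  proof (intro compact_Int_closed compact_Times compact_Icc closed_Int)
    show "closed {z. snd z \<le> cap_height \<rho> h (fst z)}"
      by (intro closed_Collect_le continuous_intros)
    show "closed (X -` (- interior S))"
      using contX by (intro closed_vimage) auto
  qed
  moreover have "(\<alpha>, \<beta>) \<in> B"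
    using nin \<alpha> \<beta> cap_le[of \<alpha>] by (auto simp: B_def X_def)
  moreover have "continuous_on B (\<lambda>z. cap_height \<rho> h (fst z) - snd z)"
    by (intro continuous_intros)
  ultimately obtain z where z: "z \<in> B"
    and zmax: "\<And>y. y \<in> B \<Longrightarrow> cap_height \<rho> h (fst y) - snd y \<le> cap_height \<rho> h (fst z) - snd z"
    using continuous_attains_sup[of B "\<lambda>z. cap_height \<rho> h (fst z) - snd z"] by blast
  obtain \<alpha>0 \<beta>0 where z_eq: "z = (\<alpha>0, \<beta>0)" by (cases z)
  define s where "s = cap_height \<rho> h \<alpha>0 - \<beta>0"
  define p where "p = m + \<alpha>0 *\<^sub>R e + \<beta>0 *\<^sub>R u"
  have z1: "\<bar>\<alpha>0\<bar> \<le> h" "0 \<le> \<beta>0" "s \<ge> 0" "p \<notin> interior S"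
    using z by (auto simp: B_def z_eq s_def X_def p_def)
  have below: "m + \<alpha> *\<^sub>R e + \<beta> *\<^sub>R u \<in> interior S"
    if "\<bar>\<alpha>\<bar> \<le> h" "0 \<le> \<beta>" "\<beta> < cap_height \<rho> h \<alpha> - s" for \<alpha> \<beta>
  proof (rule ccontr)
    assume "m + \<alpha> *\<^sub>R e + \<beta> *\<^sub>R u \<notin> interior S"
    then have "(\<alpha>, \<beta>) \<in> B" using that cap_le[of \<alpha>] z1 by (auto simp: B_def X_def)
    then show False using zmax[of "(\<alpha>, \<beta>)"] that by (simp add: z_eq s_def)
  qed
  have upto: "m + \<alpha> *\<^sub>R e + \<beta> *\<^sub>R u \<in> S"
    if "\<bar>\<alpha>\<bar> \<le> h" "0 < \<beta>" "\<beta> \<le> cap_height \<rho> h \<alpha> - s" for \<alpha> \<beta>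
  proof (rule in_closed_if_below[OF assms(1) that(2)])
    fix \<tau> assume "0 < \<tau>" "\<tau> < \<beta>"
    then have "m + \<alpha> *\<^sub>R e + (\<beta> - \<tau>) *\<^sub>R u \<in> interior S" using that by (intro below) auto
    then show "m + \<alpha> *\<^sub>R e + \<beta> *\<^sub>R u - \<tau> *\<^sub>R u \<in> S"
      using interior_subset by (auto simp: algebra_simps)
  qed
  have b0: "\<beta>0 > 0"
    using chord[OF z1(1)] z1(2,4) by (cases "\<beta>0 = 0") (auto simp: p_def)
  have a0: "\<bar>\<alpha>0\<bar> < h"
  proof (rule ccontr)
    assume "\<not> \<bar>\<alpha>0\<bar> < h"
    then have "\<alpha>0 = h \<or> \<alpha>0 = - h" using z1(1) by (auto simp: abs_if split: if_splits)
    then have "s = - \<beta>0" by (auto simp: s_def)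
    then show False using b0 z1(3) by simp
  qed
  have "p \<in> S" using upto[of \<alpha>0 \<beta>0] z1 b0 by (simp add: s_def p_def)
  then have "p \<in> frontier S" using z1(4) closure_subset by (auto simp: frontier_def)
  then obtain R where R: "0 \<le> R" "R < \<rho>" "supported_at R S p" using sup by blast
  define d where "d = sqrt (\<rho>\<^sup>2 - h\<^sup>2)"
  define \<kappa> where "\<kappa> = sqrt (\<rho>\<^sup>2 - \<alpha>0\<^sup>2)"
  have \<kappa>_eq: "\<kappa> = \<beta>0 + d + s" by (simp add: \<kappa>_def s_def cap_height_def d_def)
  have "\<bar>\<alpha>0\<bar> \<le> \<rho>" using a0 h by simp
  then have "\<alpha>0\<^sup>2 \<le> \<rho>\<^sup>2" using \<rho> by (metis abs_le_square_iff abs_of_pos)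
  then have \<kappa>2: "\<alpha>0\<^sup>2 + \<kappa>\<^sup>2 = \<rho>\<^sup>2" by (simp add: \<kappa>_def)
  have d0: "d \<ge> 0" using h by (simp add: d_def power_mono)
  have ee: "e \<bullet> e = 1" "u \<bullet> u = 1" "u \<bullet> e = 0" using e u eu by (auto simp: norm_eq_1 inner_commute)
  \<comment> \<open>inner normal and tangent of the translated arc at the contact point\<close>
  define n where "n = (- \<alpha>0 / \<rho>) *\<^sub>R e + (- \<kappa> / \<rho>) *\<^sub>R u"
  define f where "f = (\<kappa> / \<rho>) *\<^sub>R e + (- \<alpha>0 / \<rho>) *\<^sub>R u"
  have k1: "(\<alpha>0 / \<rho>)\<^sup>2 + (\<kappa> / \<rho>)\<^sup>2 = 1"
    using \<kappa>2 \<rho> by (simp add: power_divide add_divide_distrib[symmetric])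
  have "norm n = 1" "norm f = 1" "f \<bullet> n = 0"
    using ee eu k1 unfolding norm_eq_1 n_def f_def
    by (simp_all add: inner_add_left inner_add_right inner_diff_left inner_diff_right power2_eq_square)
  then show False
  proof (rule no_larger_disc_at_supported_point[OF R(3,1,2)])
    \<comment> \<open>the disc is only examined strictly above the chord and strictly between its endpoints\<close>
    define \<eta> where "\<eta> = min (h - \<bar>\<alpha>0\<bar>) \<beta>0 / 2"
    show "\<eta> > 0" using a0 b0 by (simp add: \<eta>_def)
    fix t s' assume ts: "t\<^sup>2 + s'\<^sup>2 \<le> 2 * \<rho> * s'" "\<bar>t\<bar> < \<eta>" "\<bar>s'\<bar> < \<eta>"
    define \<alpha>1 where "\<alpha>1 = \<alpha>0 + t * (\<kappa> / \<rho>) - s' * (\<alpha>0 / \<rho>)"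
    define \<beta>1 where "\<beta>1 = \<beta>0 - t * (\<alpha>0 / \<rho>) - s' * (\<kappa> / \<rho>)"
    have pt: "p + (t *\<^sub>R f + s' *\<^sub>R n) = m + \<alpha>1 *\<^sub>R e + \<beta>1 *\<^sub>R u"
      by (simp add: p_def n_def f_def \<alpha>1_def \<beta>1_def algebra_simps)
    have le1: "\<bar>\<alpha>0 / \<rho>\<bar> \<le> 1" "\<bar>\<kappa> / \<rho>\<bar> \<le> 1"
      using k1 by (simp_all only: abs_le_square_iff[of _ 1, simplified]) (smt (verit) zero_le_power2)+
    have prod: "\<bar>a * b\<bar> < \<eta>" if "\<bar>a\<bar> < \<eta>" "\<bar>b\<bar> \<le> 1" for a b :: real
      using that mult_left_le[of "\<bar>b\<bar>" "\<bar>a\<bar>"] by (simp add: abs_mult)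
    have "2 * \<eta> \<le> h - \<bar>\<alpha>0\<bar>" "2 * \<eta> \<le> \<beta>0" by (simp_all add: \<eta>_def)
    then have bnd: "\<bar>\<alpha>1\<bar> \<le> h" "\<beta>1 > 0"
      using prod[OF ts(2) le1(2)] prod[OF ts(3) le1(1)] prod[OF ts(2) le1(1)] prod[OF ts(3) le1(2)]
      unfolding \<alpha>1_def \<beta>1_def by linarith+
    have "\<alpha>1\<^sup>2 + (\<beta>1 + d + s)\<^sup>2 = (\<alpha>0\<^sup>2 + \<kappa>\<^sup>2) + (t\<^sup>2 + s'\<^sup>2) * ((\<alpha>0 / \<rho>)\<^sup>2 + (\<kappa> / \<rho>)\<^sup>2)
        - 2 * s' * ((\<alpha>0\<^sup>2 + \<kappa>\<^sup>2) / \<rho>)"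
    proof -
      have b: "\<beta>1 + d + s = \<kappa> - t * (\<alpha>0 / \<rho>) - s' * (\<kappa> / \<rho>)" by (simp add: \<beta>1_def \<kappa>_eq)
      show ?thesis unfolding b \<alpha>1_def
        by (simp add: power2_eq_square add_divide_distrib algebra_simps)
    qed
    also have "\<dots> = \<rho>\<^sup>2 + (t\<^sup>2 + s'\<^sup>2 - 2 * \<rho> * s')"
      unfolding k1 \<kappa>2 using \<rho> by (simp add: power2_eq_square)
    also have "\<dots> \<le> \<rho>\<^sup>2" using ts(1) by simp
    finally have "\<beta>1 + d + s \<le> sqrt (\<rho>\<^sup>2 - \<alpha>1\<^sup>2)"
      by (intro real_le_rsqrt) simp
    then have "\<beta>1 \<le> cap_height \<rho> h \<alpha>1 - s" by (simp add: cap_height_def d_def)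
    then show "p + (t *\<^sub>R f + s' *\<^sub>R n) \<in> S"
      unfolding pt using bnd by (intro upto)
  qed
qed

text \<open>The homothety with ratio \<open>1 - t\<close> towards an interior point \<open>q\<close> moves the chord into the interior
  without changing its direction, so that the same \<open>e\<close> and \<open>u\<close> serve for all \<open>t\<close>. The radius is
  enlarged to \<open>r + t\<close>; as this flattens the arc, the height is prescribed as a fixed fraction
  \<open>\<kappa>\<close> of the height of the arc.\<close>

lemma cap_in_closure:
  fixes S :: "'a::euclidean_space set"
  assumes "closed S" "convex (interior S)" "S \<subseteq> closure (interior S)" "interior S \<noteq> {}"
    and sup: "\<And>p R. p \<in> frontier S \<Longrightarrow> R > r \<Longrightarrow> supported_at R S p"
    and ab: "m - h *\<^sub>R e \<in> S" "m + h *\<^sub>R e \<in> S"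
    and e: "norm e = 1" and u: "norm u = 1" and eu: "e \<bullet> u = 0"
    and h: "0 \<le> h" "h \<le> r" and r: "r > 0"
    and \<alpha>: "\<bar>\<alpha>\<bar> \<le> h" and \<beta>: "0 \<le> \<beta>" "\<beta> \<le> cap_height r h \<alpha>"
  shows "m + \<alpha> *\<^sub>R e + \<beta> *\<^sub>R u \<in> S"
proof -
  obtain q where q: "q \<in> interior S" using assms(4) by blast
  define H where "H = cap_height r h \<alpha>"
  obtain \<kappa> where \<kappa>: "0 \<le> \<kappa>" "\<kappa> \<le> 1" "\<beta> = \<kappa> * H"
  proof (cases "H = 0")
    case True then show ?thesis using that[of 0] \<beta> by (simp add: H_def)
  next
    case False
    then show ?thesis using that[of "\<beta> / H"] \<beta> by (simp add: H_def divide_le_eq_1)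
  qed
  define P where "P t = ((1 - t) *\<^sub>R m + t *\<^sub>R q) + ((1 - t) * \<alpha>) *\<^sub>R e
      + (\<kappa> * cap_height (r + t) ((1 - t) * h) ((1 - t) * \<alpha>)) *\<^sub>R u" for t
  have shrink: "(1 - t) *\<^sub>R x + t *\<^sub>R q \<in> interior S" if "x \<in> S" "0 < t" "t < 1" for x t
  proof -
    have "x - (t) *\<^sub>R (x - q) \<in> interior (interior S)"
      using mem_interior_closure_convex_shrink[OF assms(2), of q x t] that assms(3) q by auto
    then show ?thesis by (simp add: algebra_simps)
  qed
  have "P t \<in> S" if t: "0 < t" "t < 1" for t
  proof -
    have "P t \<in> interior S" unfolding P_def
    proof (rule cap_in_interior[OF assms(1,2) _ _ _ e u eu])
      show "\<exists>R\<ge>0. R < r + t \<and> supported_at R S p" if "p \<in> frontier S" for p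
        using sup[OF that, of "r + t / 2"] r t by (intro exI[of _ "r + t / 2"]) auto
      show "(1 - t) *\<^sub>R m + t *\<^sub>R q - ((1 - t) * h) *\<^sub>R e \<in> interior S"
        using shrink[OF ab(1) t] by (simp add: algebra_simps)
      show "(1 - t) *\<^sub>R m + t *\<^sub>R q + ((1 - t) * h) *\<^sub>R e \<in> interior S"
        using shrink[OF ab(2) t] by (simp add: algebra_simps)
      show h1: "0 \<le> (1 - t) * h" using h t by simp
      have "(1 - t) * h \<le> 1 * h" using h t by (intro mult_right_mono) auto
      then show h2: "(1 - t) * h \<le> r + t" using h t by simp
      show "r + t > 0" using r t by simp
      show a1: "\<bar>(1 - t) * \<alpha>\<bar> \<le> (1 - t) * h" using \<alpha> t by (simp add: abs_mult mult_left_mono)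
      have "((1 - t) * \<alpha>)\<^sup>2 \<le> ((1 - t) * h)\<^sup>2" using a1 h1 by (metis abs_le_square_iff abs_of_nonneg)
      then have c0: "0 \<le> cap_height (r + t) ((1 - t) * h) ((1 - t) * \<alpha>)"
        by (simp add: cap_height_def)
      then show "0 \<le> \<kappa> * cap_height (r + t) ((1 - t) * h) ((1 - t) * \<alpha>)" using \<kappa> by simp
      show "\<kappa> * cap_height (r + t) ((1 - t) * h) ((1 - t) * \<alpha>) \<le> cap_height (r + t) ((1 - t) * h) ((1 - t) * \<alpha>)"
        using c0 \<kappa> by (simp add: mult_left_le_one_le)
    qed
    then show ?thesis using interior_subset by blast
  qed
  then have "eventually (\<lambda>t. P t \<in> S) (at_right 0)"
    by (auto simp: eventually_at_right_field intro!: exI[of _ 1])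
  moreover have "(P \<longlongrightarrow> P 0) (at_right 0)"
    unfolding P_def cap_height_def by (intro tendsto_intros)
  ultimately have "P 0 \<in> S" using Lim_in_closed_set[OF assms(1)] by (metis trivial_limit_at_right_real)
  then show ?thesis by (simp add: P_def \<kappa> H_def)
qed

lemma plane_coordinates:
  fixes e v :: "'a::euclidean_space"
  assumes "DIM('a) \<ge> 2" "norm e = 1"
  obtains \<alpha> \<beta> u where "norm u = 1" "e \<bullet> u = 0" "\<beta> \<ge> 0" "v = \<alpha> *\<^sub>R e + \<beta> *\<^sub>R u"
proof -
  define w where "w = v - (v \<bullet> e) *\<^sub>R e"
  have we: "e \<bullet> w = 0"
    using assms(2) by (simp add: w_def inner_diff_right inner_commute norm_eq_1)
  show thesis
  proof (cases "w = 0")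
    case True
    obtain u where "u \<noteq> 0" "orthogonal e u" using orthogonal_to_vector_exists[OF assms(1)] by blast
    then show ?thesis using that[of "u /\<^sub>R norm u" 0 "v \<bullet> e"] True by (simp add: orthogonal_def w_def)
  next
    case False
    then show ?thesis using that[of "w /\<^sub>R norm w" "norm w" "v \<bullet> e"] we by (simp add: w_def)
  qed
qed

lemma norm_plane_coordinates:
  fixes e u :: "'a::real_inner"
  assumes "norm e = 1" "norm u = 1" "e \<bullet> u = 0"
  shows "(norm (a *\<^sub>R e + b *\<^sub>R u))\<^sup>2 = a\<^sup>2 + b\<^sup>2"
  using assms unfolding power2_norm_eq_inner norm_eq_1
  by (simp add: inner_add_left inner_add_right inner_commute[of u e] power2_eq_square)

text \<open>The caps over a diameter are half discs, and together they form a ball of radius \<open>\<rho> > r\<close>. The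
  largest concentric ball inside the set would touch the boundary, which is excluded.\<close>

lemma far_points_imp_UNIV:
  fixes S :: "'a::euclidean_space set"
  assumes dim: "DIM('a) \<ge> 2" and "closed S" "convex (interior S)" 
    and sup: "\<And>p R. p \<in> frontier S \<Longrightarrow> R > r \<Longrightarrow> supported_at R S p"
    and r: "r > 0" and ab: "a \<in> interior S" "b \<in> interior S" "dist a b > 2 * r"
  shows "S = UNIV"
proof (rule ccontr)
  assume "S \<noteq> UNIV"
  define \<rho> where "\<rho> = dist a b / 2"
  define m where "m = (1/2) *\<^sub>R (a + b)"
  define e where "e = (1 / (2 * \<rho>)) *\<^sub>R (b - a)"
  have \<rho>: "\<rho> > r" "\<rho> > 0" using ab(3) r by (auto simp: \<rho>_def)
  have e: "norm e = 1" using \<rho> by (simp add: e_def \<rho>_def dist_norm norm_minus_commute)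
  have re: "\<rho> *\<^sub>R e = (1/2) *\<^sub>R (b - a)" using \<rho> by (simp add: e_def)
  have half: "(1/2) *\<^sub>R x + (1/2) *\<^sub>R x = x" for x :: 'a by (simp add: scaleR_2[symmetric] flip: scaleR_add_left)
  have ae: "a = m - \<rho> *\<^sub>R e" "b = m + \<rho> *\<^sub>R e"
    unfolding re m_def using half[of a] half[of b] by (simp_all add: algebra_simps)
  have sup': "\<exists>R\<ge>0. R < \<rho> \<and> supported_at R S p" if "p \<in> frontier S" for p
    using sup[OF that, of "(r + \<rho>) / 2"] \<rho> r by (intro exI[of _ "(r + \<rho>) / 2"]) auto
  have ball_in: "m + v \<in> interior S" if v: "norm v \<le> \<rho>" for v
  proof -
    obtain \<alpha> \<beta> u where u: "norm u = 1" "e \<bullet> u = 0" "\<beta> \<ge> 0" and v_eq: "v = \<alpha> *\<^sub>R e + \<beta> *\<^sub>R u"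
      using plane_coordinates[OF dim e] by blast
    have nv: "\<alpha>\<^sup>2 + \<beta>\<^sup>2 \<le> \<rho>\<^sup>2"
      using v power_mono[of "norm v" \<rho> 2] norm_plane_coordinates[OF e u(1,2)] by (simp add: v_eq)
    have "m + \<alpha> *\<^sub>R e + \<beta> *\<^sub>R u \<in> interior S"
    proof (rule cap_in_interior[OF assms(2,3) sup' ab(1,2)[unfolded ae] e u(1,2)])
      have "\<alpha>\<^sup>2 \<le> \<rho>\<^sup>2" using nv by (smt (verit) zero_le_power2)
      then show "\<bar>\<alpha>\<bar> \<le> \<rho>" using \<rho> by (metis abs_le_square_iff abs_of_pos)
      show "\<beta> \<le> cap_height \<rho> \<rho> \<alpha>"
        using nv by (simp add: cap_height_def) (rule real_le_rsqrt, simp)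
    qed (use \<rho> u in auto)
    then show ?thesis by (simp add: v_eq add.assoc)
  qed
  have "m \<in> interior S" using ball_in[of 0] \<rho> by simp
  have "frontier S \<noteq> {}"
    using \<open>m \<in> interior S\<close> \<open>S \<noteq> UNIV\<close> interior_subset by (auto simp: frontier_eq_empty)
  then obtain p where p: "p \<in> frontier S" and pmin: "\<And>y. y \<in> frontier S \<Longrightarrow> dist m p \<le> dist m y"
    using distance_attains_inf[of "frontier S" m] frontier_closed by blast
  define \<tau> where "\<tau> = dist m p"
  have pS: "p \<notin> interior S" "p \<in> S" using p assms(2) by (auto simp: frontier_def)
  have \<tau>: "\<tau> > \<rho>"
    using ball_in[of "p - m"] pS by (force simp: \<tau>_def dist_norm norm_minus_commute)
  have "ball m \<tau> \<subseteq> S"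
  proof (rule ccontr)
    assume "\<not> ball m \<tau> \<subseteq> S"
    then have "ball m \<tau> - S \<noteq> {}" by blast
    moreover have "m \<in> ball m \<tau> \<inter> S"
      using \<tau> \<rho> subsetD[OF interior_subset \<open>m \<in> interior S\<close>] by simp
    then have "ball m \<tau> \<inter> S \<noteq> {}" by (rule ex_in_conv[THEN iffD1, OF exI])
    ultimately obtain y where "dist m y < \<tau>" "y \<in> frontier S"
      using connected_Int_frontier[OF connected_ball, of m \<tau> S] by (auto simp: ball_def)
    then show False using pmin[of y] by (simp add: \<tau>_def)
  qed
  then have cb: "cball m \<tau> \<subseteq> S"
    using closure_minimal[OF _ assms(2), of "ball m \<tau>"] \<tau> \<rho> by simp
  define n where "n = (1 / \<tau>) *\<^sub>R (m - p)"
  have n: "norm n = 1" "m = p + \<tau> *\<^sub>R n" using \<tau> \<rho> by (auto simp: n_def \<tau>_def dist_norm)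
  obtain f where f: "norm f = 1" "n \<bullet> f = 0"
    using plane_coordinates[OF dim n(1)] by blast
  obtain R where R: "R \<ge> 0" "R < \<rho>" "supported_at R S p" using sup'[OF p] by blast
  show False
  proof (rule no_larger_disc_at_supported_point[OF R(3,1) _ n(1) f(1), of \<tau> 1])
    fix t s assume ts: "t\<^sup>2 + s\<^sup>2 \<le> 2 * \<tau> * s"
    have "(norm (t *\<^sub>R f + (s - \<tau>) *\<^sub>R n))\<^sup>2 = t\<^sup>2 + (s - \<tau>)\<^sup>2"
      using norm_plane_coordinates[OF f(1) n(1)] f(2) by (simp add: inner_commute)
    also have "\<dots> \<le> \<tau>\<^sup>2" using ts by (simp add: power2_eq_square algebra_simps)
    finally have "norm (t *\<^sub>R f + (s - \<tau>) *\<^sub>R n) \<le> \<tau>"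
      by (rule power2_le_imp_le) (use \<tau> \<rho> in simp)
    moreover have "t *\<^sub>R f + (s - \<tau>) *\<^sub>R n = p + (t *\<^sub>R f + s *\<^sub>R n) - m"
      by (subst n(2)) (simp add: algebra_simps)
    ultimately have "p + (t *\<^sub>R f + s *\<^sub>R n) \<in> cball m \<tau>"
      by (metis mem_cball dist_norm dist_commute)
    then show "p + (t *\<^sub>R f + s *\<^sub>R n) \<in> S" using cb by blast
  qed (use R \<tau> f(2) in \<open>auto simp: inner_commute\<close>)
qed

lemma eq_if_in_all_cballs:
  fixes x z :: "'a::real_normed_vector"
  assumes "r > 0" and zc: "\<And>c. dist c x \<le> r \<Longrightarrow> dist c z \<le> r"
  shows "z = x"
proof (rule ccontr)
  assume "z \<noteq> x"
  define v where "v = (z - x) /\<^sub>R norm (z - x)"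
  have v: "norm v = 1" "z - x = norm (z - x) *\<^sub>R v" using \<open>z \<noteq> x\<close> by (auto simp: v_def)
  have "z - (x - r *\<^sub>R v) = (norm (z - x) + r) *\<^sub>R v"
    using v(2) by (simp add: algebra_simps)
  then have "dist (x - r *\<^sub>R v) z = norm (z - x) + r"
    using v(1) assms(1) by (simp add: dist_norm norm_minus_commute)
  moreover have "dist (x - r *\<^sub>R v) z \<le> r" using v assms(1) by (intro zc) (auto simp: dist_norm)
  ultimately show False using \<open>z \<noteq> x\<close> by simp
qed

lemma r_convex_singleton:
  fixes x :: "'a::real_normed_vector"
  assumes "r > 0"
  shows "r_convex r {x}"
  unfolding r_convex_def
proof (intro ballI subsetI)
  fix a b z assume "a \<in> {x}" "b \<in> {x}" and z: "z \<in> \<Inter> {cball c r |c. a \<in> cball c r \<and> b \<in> cball c r}"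
  then have "dist c z \<le> r" if "dist c x \<le> r" for c using that by auto
  then show "z \<in> {x}" using eq_if_in_all_cballs[OF assms] by blast
qed

text \<open>For \<open>x \<noteq> y\<close> at distance at most \<open>2 r\<close>, a point \<open>z\<close> of the intersection of balls lies in a half
  plane bounded by the line through \<open>x\<close> and \<open>y\<close>. Among the balls of radius \<open>r\<close> through both points, the one
  with its centre in the plane of this half plane, but on the other side of the line, confines \<open>z\<close>
  to the minor cap over the chord.\<close>

theorem r_convex_if_locally_supported:
  fixes S :: "'a::euclidean_space set"
  assumes dim: "DIM('a) \<ge> 2" and r: "r > 0" and "closed S" "connected (interior S)"
    "S \<subseteq> closure (interior S)"
    and sup: "\<And>p R. p \<in> frontier S \<Longrightarrow> R > r \<Longrightarrow> supported_at R S p"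
  shows "r_convex r S"
  unfolding r_convex_def
proof (intro ballI subsetI)
  fix x y z assume x: "x \<in> S" and y: "y \<in> S"
    and z: "z \<in> \<Inter> {cball c r |c. x \<in> cball c r \<and> y \<in> cball c r}"
  have zc: "dist c z \<le> r" if "dist c x \<le> r" "dist c y \<le> r" for c
    using z that by auto
  have conv: "convex (interior S)"
  proof (rule convex_interior_if_supported[OF assms(3,4)])
    show "\<exists>R\<ge>0. supported_at R S p" if "p \<in> frontier S" for p
      using sup[OF that, of "r + 1"] r by (intro exI[of _ "r + 1"]) auto
  qed
  have ne: "interior S \<noteq> {}" using x assms(5) by auto
  show "z \<in> S"
  proof (cases "dist x y > 2 * r")
    case True
    define \<epsilon> where "\<epsilon> = (dist x y - 2 * r) / 2"
    obtain a b where a: "a \<in> interior S" "dist a x < \<epsilon>" and b: "b \<in> interior S" "dist b y < \<epsilon>"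
      using x y assms(5) True unfolding \<epsilon>_def closure_approachable subset_iff
      by (metis diff_gt_0_iff_gt half_gt_zero)
    have "dist x y \<le> dist a x + dist a b + dist b y"
      by metric
    then have "dist a b > 2 * r" using a b by (simp add: \<epsilon>_def field_simps)
    then show ?thesis using far_points_imp_UNIV[OF dim assms(3) conv sup r a(1) b(1)] by auto
  next
    case False
    define h where "h = dist x y / 2"
    define m where "m = (1/2) *\<^sub>R (x + y)"
    have h: "0 \<le> h" "h \<le> r" using False by (auto simp: h_def)
    have half: "(1/2) *\<^sub>R w + (1/2) *\<^sub>R w = w" for w :: 'a by (simp flip: scaleR_add_left)
    show ?thesis
    proof (cases "x = y")
      case True
      have "z = x" using zc True by (intro eq_if_in_all_cballs[OF r]) auto
      then show ?thesis using x by simp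
    next
      case xy: False
      define e where "e = (1 / (2 * h)) *\<^sub>R (y - x)"
      have h0: "h > 0" using xy by (simp add: h_def)
      have e: "norm e = 1" using h0 by (simp add: e_def h_def dist_norm norm_minus_commute)
      have re: "h *\<^sub>R e = (1/2) *\<^sub>R (y - x)" using h0 by (simp add: e_def)
      have xe: "x = m - h *\<^sub>R e" "y = m + h *\<^sub>R e"
        unfolding re m_def using half[of x] half[of y] by (simp_all add: algebra_simps)
      obtain \<alpha> \<beta> u where u: "norm u = 1" "e \<bullet> u = 0" "\<beta> \<ge> 0" and v_eq: "z - m = \<alpha> *\<^sub>R e + \<beta> *\<^sub>R u"
        using plane_coordinates[OF dim e] by blast
      have zm: "z = m + \<alpha> *\<^sub>R e + \<beta> *\<^sub>R u" using v_eq by (simp add: algebra_simps)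
      note nrm = norm_plane_coordinates[OF e u(1,2)]
      define d where "d = sqrt (r\<^sup>2 - h\<^sup>2)"
      have "h\<^sup>2 \<le> r\<^sup>2" using h by (simp add: power_mono)
      then have d: "d \<ge> 0" "d\<^sup>2 = r\<^sup>2 - h\<^sup>2" by (auto simp: d_def)
      define c where "c = m - d *\<^sub>R u"
      have "x - c = (- h) *\<^sub>R e + d *\<^sub>R u" "y - c = h *\<^sub>R e + d *\<^sub>R u" "z - c = \<alpha> *\<^sub>R e + (\<beta> + d) *\<^sub>R u"
        by (subst xe zm, simp add: c_def algebra_simps)+
      then have nn: "(norm (x - c))\<^sup>2 = r\<^sup>2" "(norm (y - c))\<^sup>2 = r\<^sup>2" "(norm (z - c))\<^sup>2 = \<alpha>\<^sup>2 + (\<beta> + d)\<^sup>2"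
        using d by (simp_all add: nrm del: scaleR_minus_left)
      have "dist c z \<le> r"
        using nn r by (intro zc) (auto simp: dist_norm norm_minus_commute power2_eq_iff_nonneg)
      then have "(norm (z - c))\<^sup>2 \<le> r\<^sup>2" by (simp add: dist_norm norm_minus_commute power_mono)
      then have ub: "\<beta> + d \<le> sqrt (r\<^sup>2 - \<alpha>\<^sup>2)"
        using nn(3) by (intro real_le_rsqrt) simp
      have "d \<le> sqrt (r\<^sup>2 - \<alpha>\<^sup>2)" using ub u(3) by linarith
      then have "\<alpha>\<^sup>2 \<le> h\<^sup>2" by (simp add: d_def)
      then have "\<bar>\<alpha>\<bar> \<le> h" using h by (metis abs_le_square_iff abs_of_nonneg)
      moreover have "\<beta> \<le> cap_height r h \<alpha>" using ub by (simp add: cap_height_def d_def)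
      ultimately have "m + \<alpha> *\<^sub>R e + \<beta> *\<^sub>R u \<in> S"
        using x y unfolding xe
        by (intro cap_in_closure[OF assms(3) conv assms(5) ne sup _ _ e u(1,2) h r _ u(3)]) auto
      then show ?thesis using zm by simp
    qed
  qed
qed

section \<open>Directions that enter the interior\<close>

definition inward_at :: "'a::real_normed_vector set \<Rightarrow> 'a \<Rightarrow> bool" where
  "inward_at S x \<longleftrightarrow>
     (\<exists>d \<epsilon>. \<epsilon> > 0 \<and> (\<forall>y\<in>S \<inter> ball x \<epsilon>. \<forall>t. 0 < t \<and> t \<le> \<epsilon> \<longrightarrow> y + t *\<^sub>R d \<in> interior S))"

lemma inward_at_imp_closure_interior:
  assumes "inward_at S x" "x \<in> S"
  shows "x \<in> closure (interior S)"
proof -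
  obtain d \<epsilon> where e: "\<epsilon> > 0"
    "\<And>y t. y \<in> S \<inter> ball x \<epsilon> \<Longrightarrow> 0 < t \<Longrightarrow> t \<le> \<epsilon> \<Longrightarrow> y + t *\<^sub>R d \<in> interior S"
    using assms(1) unfolding inward_at_def by blast
  have "x + t *\<^sub>R d \<in> closure (interior S)" if "0 < t" "t < \<epsilon>" for t
    using e(2)[of x t] that assms(2) e(1) closure_subset by auto
  then have "eventually (\<lambda>t. x + t *\<^sub>R d \<in> closure (interior S)) (at_right 0)"
    using e(1) by (auto simp: eventually_at_right_field)
  moreover have "((\<lambda>t. x + t *\<^sub>R d) \<longlongrightarrow> x + 0 *\<^sub>R d) (at_right 0)"
    by (intro tendsto_intros)
  ultimately have "x + 0 *\<^sub>R d \<in> closure (interior S)"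
    by (rule Lim_in_closed_set[OF closed_closure _ trivial_limit_at_right_real])
  then show ?thesis by simp
qed

text \<open>Each interior point near \<open>x\<close> is joined by an inward segment to one fixed small ball, which
  contains \<open>x + \<epsilon> d\<close>.\<close>

lemma inward_at_imp_locally_one_component:
  assumes "inward_at S x" "x \<in> S"
  shows "\<exists>\<delta> T. \<delta> > 0 \<and> connected T \<and> T \<subseteq> interior S \<and> interior S \<inter> ball x \<delta> \<subseteq> T"
proof -
  obtain d \<epsilon> where e: "\<epsilon> > 0"
    "\<And>y t. y \<in> S \<inter> ball x \<epsilon> \<Longrightarrow> 0 < t \<Longrightarrow> t \<le> \<epsilon> \<Longrightarrow> y + t *\<^sub>R d \<in> interior S"
    using assms(1) unfolding inward_at_def by blast
  have "x + \<epsilon> *\<^sub>R d \<in> interior S" using e assms(2) by auto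
  then obtain \<eta> where \<eta>: "\<eta> > 0" "ball (x + \<epsilon> *\<^sub>R d) \<eta> \<subseteq> interior S"
    by (meson open_contains_ball open_interior)
  define \<delta> where "\<delta> = min \<epsilon> \<eta>"
  define N where "N = interior S \<inter> ball x \<delta>"
  define D where "D = ball (x + \<epsilon> *\<^sub>R d) \<eta>"
  define T where "T = D \<union> (\<Union>y\<in>N. closed_segment y (y + \<epsilon> *\<^sub>R d))"
  have yb: "y + \<epsilon> *\<^sub>R d \<in> D" if "y \<in> N" for y
    using that by (auto simp: N_def \<delta>_def D_def dist_norm)
  have "connected T"
    unfolding T_def
  proof (rule connected_Un_UN)
    show "connected D" by (simp add: D_def)
  qed (use yb in auto)
  moreover have "closed_segment y (y + \<epsilon> *\<^sub>R d) \<subseteq> interior S" if y: "y \<in> N" for y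
  proof
    fix z assume "z \<in> closed_segment y (y + \<epsilon> *\<^sub>R d)"
    then obtain u where u: "0 \<le> u" "u \<le> 1" "z = (1 - u) *\<^sub>R y + u *\<^sub>R (y + \<epsilon> *\<^sub>R d)"
      by (auto simp: in_segment)
    have z_eq: "z = y + (u * \<epsilon>) *\<^sub>R d" by (simp add: u algebra_simps)
    show "z \<in> interior S"
    proof (cases "u = 0")
      case True then show ?thesis using y by (simp add: z_eq N_def)
    next
      case False
      have "u * \<epsilon> \<le> 1 * \<epsilon>" using u e(1) by (intro mult_right_mono) auto
      moreover have "y \<in> S \<inter> ball x \<epsilon>" using y interior_subset by (auto simp: N_def \<delta>_def)
      ultimately show ?thesis unfolding z_eq using False u e(1) by (intro e(2)) auto
    qed
  qed
  then have "T \<subseteq> interior S" using \<eta> by (auto simp: T_def D_def)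
  moreover have "interior S \<inter> ball x \<delta> \<subseteq> T" by (auto simp: T_def N_def)
  moreover have "\<delta> > 0" using e \<eta> by (simp add: \<delta>_def)
  ultimately show ?thesis by blast
qed

text \<open>A separation of the interior has disjoint pieces whose closures cover the set, so they meet in
  some boundary point; but near it the interior lies in one connected piece.\<close>

lemma connected_interior_if_inward:
  fixes S :: "'a::euclidean_space set"
  assumes "closed S" "connected S" and inw: "\<And>x. x \<in> frontier S \<Longrightarrow> inward_at S x"
  shows "S \<subseteq> closure (interior S)" "connected (interior S)"
proof -
  show sub: "S \<subseteq> closure (interior S)"
  proof
    fix x assume x: "x \<in> S"
    show "x \<in> closure (interior S)"
    proof (cases "x \<in> interior S")
      case False
      then have "x \<in> frontier S" using x closure_subset by (auto simp: frontier_def)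
      then show ?thesis using inward_at_imp_closure_interior inw x by blast
    qed (use closure_subset in auto)
  qed
  show "connected (interior S)"
  proof (rule ccontr)
    assume "\<not> connected (interior S)"
    then obtain A B where AB: "open A" "open B" "A \<inter> interior S \<noteq> {}" "B \<inter> interior S \<noteq> {}"
        "A \<inter> B \<inter> interior S = {}" "interior S \<subseteq> A \<union> B"
      unfolding connected_def by (metis inf_commute)
    define A' where "A' = A \<inter> interior S"
    define B' where "B' = B \<inter> interior S"
    have AB': "open A'" "open B'" "A' \<noteq> {}" "B' \<noteq> {}" "A' \<inter> B' = {}" "interior S = A' \<union> B'"
      using AB by (auto simp: A'_def B'_def)
    have "closure (interior S) \<subseteq> S" using assms(1) by (simp add: closure_minimal interior_subset)
    then have "closure A' \<union> closure B' = S" unfolding closure_Un[symmetric] using sub AB'(6) by auto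
    then have "closure A' \<inter> closure B' \<noteq> {}"
      using connected_closedD[OF assms(2), of "closure A'" "closure B'"] AB'(3,4)
        closure_subset[of A'] closure_subset[of B'] by auto
    then obtain x where x: "x \<in> closure A'" "x \<in> closure B'" by blast
    have xS: "x \<in> S" using x \<open>closure A' \<union> closure B' = S\<close> by blast
    show False
    proof (cases "x \<in> interior S")
      case True
      then have "x \<in> A' \<or> x \<in> B'" using AB' by blast
      then show False
        using x AB' open_Int_closure_eq_empty[of A' B'] open_Int_closure_eq_empty[of B' A'] by blast
    next
      case False
      then have "x \<in> frontier S" using xS closure_subset by (auto simp: frontier_def)
      then obtain \<delta> T where T: "\<delta> > 0" "connected T" "T \<subseteq> interior S" "interior S \<inter> ball x \<delta> \<subseteq> T"
        using inward_at_imp_locally_one_component[OF inw xS] by blast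
      obtain p where p: "p \<in> A'" "dist p x < \<delta>" using x(1) T(1) by (auto simp: closure_approachable)
      obtain q where q: "q \<in> B'" "dist q x < \<delta>" using x(2) T(1) by (auto simp: closure_approachable)
      have "p \<in> T" "q \<in> T" using p q T(4) AB'(6) by (auto simp: dist_commute)
      then show False
        using connectedD[OF T(2) AB'(1,2)] p q T(3) AB'(5,6) by blast
    qed
  qed
qed

section \<open>From the curvature inequality to tangent balls\<close>

definition lipschitz_derivative_on :: "real \<Rightarrow> 'a::real_normed_vector set \<Rightarrow> ('a \<Rightarrow> real) \<Rightarrow> bool" where
  "lipschitz_derivative_on L V f \<longleftrightarrow> L \<ge> 0 \<and>
     (\<forall>y\<in>V. (f has_derivative blinfun_apply (fderiv f y)) (at y)) \<and>
     (\<forall>y\<in>V. \<forall>z\<in>V. norm (fderiv f y - fderiv f z) \<le> L * norm (y - z))"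

lemma has_derivative_fderiv:
  "f differentiable (at x) \<Longrightarrow> (f has_derivative blinfun_apply (fderiv f x)) (at x)"
  unfolding fderiv_def frechet_derivative_works
  by (simp add: bounded_linear_Blinfun_apply[OF has_derivative_bounded_linear])

lemma C11_submersionE:
  assumes "C11_submersion_on_zero_set U f" "x \<in> U" "f x = 0"
  obtains \<delta> L where "\<delta> > 0" "lipschitz_derivative_on L (ball x \<delta>) f" "fderiv f x \<noteq> 0"
proof -
  obtain V where V: "open V" "x \<in> V" "C11_on V f" and s: "surj (blinfun_apply (fderiv f x))"
    using assms unfolding C11_submersion_on_zero_set_def by (elim ballE[of _ _ x]) auto
  obtain \<delta> where \<delta>: "\<delta> > 0" "ball x \<delta> \<subseteq> V" using V by (meson open_contains_ball)
  obtain L where L: "L-lipschitz_on V (fderiv f)" using V(3) unfolding C11_on_def by blast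
  have "lipschitz_derivative_on L (ball x \<delta>) f"
    unfolding lipschitz_derivative_on_def
  proof (intro conjI ballI)
    show "L \<ge> 0" using L by (rule lipschitz_on_nonneg)
    show "(f has_derivative blinfun_apply (fderiv f y)) (at y)" if "y \<in> ball x \<delta>" for y
    proof (rule has_derivative_fderiv)
      show "f differentiable (at y)" using that \<delta>(2) V(3) unfolding C11_on_def by blast
    qed
    show "norm (fderiv f y - fderiv f z) \<le> L * norm (y - z)" if "y \<in> ball x \<delta>" "z \<in> ball x \<delta>" for y z
      using lipschitz_onD[OF L, of y z] that \<delta>(2) unfolding dist_norm by blast
  qed
  moreover have "fderiv f x \<noteq> 0"
  proof
    assume "fderiv f x = 0"
    then have "(1::real) \<notin> range (blinfun_apply (fderiv f x))" by auto
    then show False using s by simp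
  qed
  ultimately show ?thesis using that \<delta>(1) by blast
qed

lemma lipschitz_derivative_apply:
  assumes "lipschitz_derivative_on L V f" "y \<in> V" "z \<in> V"
  shows "\<bar>fderiv f y h - fderiv f z h\<bar> \<le> L * norm (y - z) * norm h"
proof -
  have "\<bar>fderiv f y h - fderiv f z h\<bar> \<le> norm (fderiv f y - fderiv f z) * norm h"
    using norm_blinfun[of "fderiv f y - fderiv f z" h] by (simp add: blinfun.diff_left)
  also have "\<dots> \<le> L * norm (y - z) * norm h"
    using assms by (intro mult_right_mono) (auto simp: lipschitz_derivative_on_def)
  finally show ?thesis .
qed

lemma DERIV_along_line:
  fixes f :: "'a::real_normed_vector \<Rightarrow> real"
  assumes "(f has_derivative blinfun_apply (fderiv f (x + s *\<^sub>R v))) (at (x + s *\<^sub>R v))"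
  shows "((\<lambda>s. f (x + s *\<^sub>R v)) has_real_derivative fderiv f (x + s *\<^sub>R v) v) (at s)"
proof -
  have "((\<lambda>s. x + s *\<^sub>R v) has_derivative (\<lambda>t. t *\<^sub>R v)) (at s)"
    by (auto intro!: derivative_eq_intros)
  from has_derivative_compose[OF this assms]
  show ?thesis by (simp add: has_field_derivative_def blinfun.scaleR_right mult.commute[of _ "fderiv f _ v"] cong: )
qed

lemma blinfun_eq_inner:
  fixes F :: "'a::euclidean_space \<Rightarrow>\<^sub>L real"
  obtains G where "\<And>h. F h = G \<bullet> h"
proof
  fix h
  have "F h = F (\<Sum>b\<in>Basis. (h \<bullet> b) *\<^sub>R b)" by (simp add: euclidean_representation)
  also have "\<dots> = (\<Sum>b\<in>Basis. F b *\<^sub>R b) \<bullet> h"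
    by (simp add: blinfun.sum_right blinfun.scaleR_right inner_sum_left inner_commute[of h] mult.commute)
  finally show "F h = (\<Sum>b\<in>Basis. F b *\<^sub>R b) \<bullet> h" .
qed

lemma gradient_of_functional:
  fixes F :: "'a::euclidean_space \<Rightarrow>\<^sub>L real"
  assumes "F \<noteq> 0"
  obtains \<nu> where "norm \<nu> = 1" "\<And>h. F h = norm F * (\<nu> \<bullet> h)"
proof -
  obtain G where FG: "\<And>h. F h = G \<bullet> h" using blinfun_eq_inner by blast
  have "norm F \<le> norm G"
    by (rule norm_blinfun_bound) (auto simp: FG Cauchy_Schwarz_ineq2)
  moreover have "norm G * norm G \<le> norm F * norm G"
    using norm_blinfun[of F G] by (simp add: FG power2_norm_eq_inner[symmetric] power2_eq_square)
  then have "norm G \<le> norm F" by (cases "G = 0") auto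
  ultimately have n: "norm F = norm G" by simp
  have "G \<noteq> 0" using n assms by auto
  then show ?thesis using that[of "G /\<^sub>R norm G"] n by (simp add: FG)
qed

lemma curvature_ineq_iff:
  "curvature_ineq r f x h \<longleftrightarrow>
     (\<forall>c < 1 / r * norm (fderiv f x) * (norm h)\<^sup>2.
        eventually (\<lambda>t. c < fderiv f (x + t *\<^sub>R h) h / t) (at_right 0))"
  (is "_ \<longleftrightarrow> (\<forall>c < ?b. ?E c)")
proof
  assume "curvature_ineq r f x h"
  then have *: "\<And>y. y < ereal ?b \<Longrightarrow> eventually (\<lambda>t. y < ereal (fderiv f (x + t *\<^sub>R h) h / t)) (at_right 0)"
    unfolding curvature_ineq_def le_Liminf_iff by blast
  show "\<forall>c < ?b. ?E c"
    using *[of "ereal c" for c] by simp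
next
  assume *: "\<forall>c < ?b. ?E c"
  show "curvature_ineq r f x h"
    unfolding curvature_ineq_def le_Liminf_iff
  proof (intro allI impI)
    fix y assume "y < ereal ?b"
    then show "eventually (\<lambda>t. y < ereal (fderiv f (x + t *\<^sub>R h) h / t)) (at_right 0)"
      using * by (cases y) auto
  qed
qed

text \<open>A lower bound \<open>c s\<close> for the derivative along a tangent direction \<open>w\<close> is integrated along a
  neighbouring direction \<open>v\<close>. Replacing the base point \<open>x + s w\<close> by \<open>x + s v\<close> and then the
  direction \<open>w\<close> by \<open>v\<close> changes the increment of the derivative by at most \<open>L s \<parallel>v - w\<parallel>\<close> each, whence the correction to \<open>c\<close>. Hence mere
  convergence of \<open>v\<close> to \<open>w\<close> suffices to keep the bound up to an arbitrarily small loss.\<close>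

lemma second_order_lower_bound:
  fixes x w v :: "'a::real_normed_vector"
  assumes lip: "lipschitz_derivative_on L (ball x \<delta>) f"
    and t: "0 < t" "t < \<delta>" and v: "norm v = 1" and w: "norm w = 1" and Fw: "fderiv f x w = 0"
    and c: "\<And>s. 0 < s \<Longrightarrow> s \<le> t \<Longrightarrow> c * s \<le> fderiv f (x + s *\<^sub>R w) w"
  shows "f x + t * fderiv f x v + (c - 2 * L * norm (v - w)) * t\<^sup>2 / 2 \<le> f (x + t *\<^sub>R v)"
proof -
  define K where "K = c - 2 * L * norm (v - w)"
  define \<phi> where "\<phi> s = f (x + s *\<^sub>R v) - s * fderiv f x v - K * s\<^sup>2 / 2" for s
  have mem: "x + s *\<^sub>R v \<in> ball x \<delta>" "x + s *\<^sub>R w \<in> ball x \<delta>" if "0 \<le> s" "s \<le> t" for s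
    using that t v w by (auto simp: dist_norm)
  have "\<phi> 0 \<le> \<phi> t"
  proof (rule DERIV_nonneg_imp_nondecreasing[of 0 t \<phi>])
    show "0 \<le> t" using t by simp
  next
    fix s assume s: "0 \<le> s" "s \<le> t"
    have d: "(f has_derivative blinfun_apply (fderiv f (x + s *\<^sub>R v))) (at (x + s *\<^sub>R v))"
      using lip mem(1)[OF s] by (simp add: lipschitz_derivative_on_def)
    have "(\<phi> has_real_derivative (fderiv f (x + s *\<^sub>R v) v - fderiv f x v - K * s)) (at s)"
      unfolding \<phi>_def by (auto intro!: derivative_eq_intros DERIV_along_line[OF d])
    moreover have "0 \<le> fderiv f (x + s *\<^sub>R v) v - fderiv f x v - K * s"
    proof -
      have x: "x \<in> ball x \<delta>" using t by simp
      have a: "\<bar>fderiv f (x + s *\<^sub>R v) w - fderiv f (x + s *\<^sub>R w) w\<bar> \<le> L * (s * norm (v - w))"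
        using lipschitz_derivative_apply[OF lip mem[OF s], of w] w s(1)
        by (simp add: scaleR_diff_right[symmetric])
      have b: "\<bar>fderiv f (x + s *\<^sub>R v) (v - w) - fderiv f x (v - w)\<bar> \<le> L * (s * norm (v - w))"
        using lipschitz_derivative_apply[OF lip mem(1)[OF s] x, of "v - w"] v s(1) by simp
      have cs: "c * s \<le> fderiv f (x + s *\<^sub>R w) w"
        using c[of s] s Fw by (cases "s = 0") auto
      have "K * s = c * s - L * (s * norm (v - w)) - L * (s * norm (v - w))"
        by (simp add: K_def algebra_simps)
      then show ?thesis using a b cs Fw by (simp add: blinfun.diff_right)
    qed
    ultimately show "\<exists>y. (\<phi> has_real_derivative y) (at s) \<and> 0 \<le> y" by blast
  qed
  then show ?thesis by (simp add: \<phi>_def K_def)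
qed

lemma derivative_on_tangent_direction:
  fixes v :: "nat \<Rightarrow> 'a::real_normed_vector"
  assumes "(f has_derivative blinfun_apply F) (at x)" "f x = (0::real)"
    and "\<And>k. f (x + v k) \<le> 0" "\<And>k. v k \<noteq> 0" "v \<longlonglongrightarrow> 0" "(\<lambda>k. v k /\<^sub>R norm (v k)) \<longlonglongrightarrow> w"
  shows "F w \<le> 0"
proof -
  have "(\<lambda>h. norm (f (x + h) - f x - F h) / norm h) \<midarrow>0\<rightarrow> 0"
    using assms(1) by (simp add: has_derivative_at)
  moreover have "filterlim v (at 0) sequentially"
    using assms(4,5) by (auto simp: filterlim_at)
  ultimately have "(\<lambda>k. norm (f (x + v k) - f x - F (v k)) / norm (v k)) \<longlonglongrightarrow> 0"
    by (rule filterlim_compose)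
  then have "(\<lambda>k. \<bar>(f (x + v k) - F (v k)) / norm (v k)\<bar>) \<longlonglongrightarrow> 0"
    using assms(2) by (simp add: abs_divide)
  then have "(\<lambda>k. (f (x + v k) - F (v k)) / norm (v k)) \<longlonglongrightarrow> 0"
    by (rule tendsto_rabs_zero_cancel)
  moreover have "(\<lambda>k. F (v k /\<^sub>R norm (v k))) \<longlonglongrightarrow> F w"
    by (intro tendsto_intros assms(6))
  ultimately have "(\<lambda>k. (f (x + v k) - F (v k)) / norm (v k) + F (v k /\<^sub>R norm (v k))) \<longlonglongrightarrow> 0 + F w"
    by (rule tendsto_add)
  moreover have "(f (x + v k) - F (v k)) / norm (v k) + F (v k /\<^sub>R norm (v k)) = f (x + v k) / norm (v k)" for k
    by (simp add: blinfun.scaleR_right divide_inverse algebra_simps)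
  ultimately have "(\<lambda>k. f (x + v k) / norm (v k)) \<longlonglongrightarrow> F w" by simp
  then show ?thesis
    by (rule LIMSEQ_le_const2) (auto intro!: exI[of _ 0] divide_nonpos_nonneg assms(3))
qed

text \<open>If no ball of radius \<open>R\<close> with normal \<open>\<nu>\<close> works, then there are points \<open>x + u k\<close> of \<open>S\<close> outside it that tend
  to \<open>x\<close>, with directions converging to some \<open>w\<close>. Being outside the ball forces \<open>\<nu> \<bullet> w \<ge> 0\<close>,
  being in \<open>S\<close> forces \<open>\<nu> \<bullet> w \<le> 0\<close>, so the curvature inequality applies to \<open>w\<close>; by the preceding
  estimate \<open>f (x + u k)\<close> would then be positive for large \<open>k\<close>.
  That the normal is the direction of the gradient lets the ball condition also be read as
  \<open>f'(x) (y - x) < 0\<close> for the other points \<open>y\<close> of \<open>S\<close> near \<open>x\<close>.\<close>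

lemma supported_at_if_curvature_ineq:
  fixes f :: "'a::euclidean_space \<Rightarrow> real"
  assumes lip: "lipschitz_derivative_on L (ball x \<delta>) f" "\<delta> > 0"
    and fx: "f x = 0" "fderiv f x \<noteq> 0" and S: "\<And>y. y \<in> S \<Longrightarrow> f y \<le> 0"
    and tangent: "\<And>v w. (\<And>k. x + v k \<in> S) \<Longrightarrow> (\<And>k. v k \<noteq> 0) \<Longrightarrow> v \<longlonglongrightarrow> 0 \<Longrightarrow>
      (\<lambda>k. v k /\<^sub>R norm (v k)) \<longlonglongrightarrow> w \<Longrightarrow> w \<in> K"
    and curv: "\<And>h. h \<in> K \<Longrightarrow> fderiv f x h = 0 \<Longrightarrow> curvature_ineq r f x h"
    and r: "0 < r" "r < R"
  shows "\<exists>\<nu> \<delta>. norm \<nu> = 1 \<and> \<delta> > 0 \<and> S \<inter> ball x \<delta> \<subseteq> cball (x - R *\<^sub>R \<nu>) R \<and>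
            (\<forall>h. fderiv f x h = norm (fderiv f x) * (\<nu> \<bullet> h))"
proof -
  define N where "N = norm (fderiv f x)"
  have N: "N > 0" using fx by (simp add: N_def)
  obtain \<nu> where \<nu>: "norm \<nu> = 1" "\<And>h. fderiv f x h = N * (\<nu> \<bullet> h)"
    using gradient_of_functional[OF fx(2)] unfolding N_def by blast
  have "\<exists>\<delta>>0. S \<inter> ball x \<delta> \<subseteq> cball (x - R *\<^sub>R \<nu>) R"
  proof (rule ccontr)
    assume no: "\<nexists>\<delta>. \<delta> > 0 \<and> S \<inter> ball x \<delta> \<subseteq> cball (x - R *\<^sub>R \<nu>) R"
    have "\<exists>v. x + v \<in> S \<and> norm v < 1 / real (Suc k) \<and> (norm v)\<^sup>2 + 2 * R * (\<nu> \<bullet> v) > 0" for k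
    proof -
      have "\<not> S \<inter> ball x (1 / real (Suc k)) \<subseteq> cball (x - R *\<^sub>R \<nu>) R"
        using no by (metis of_nat_0_less_iff zero_less_Suc zero_less_divide_1_iff)
      then obtain y where y: "y \<in> S" "y \<in> ball x (1 / real (Suc k))" "y \<notin> cball (x - R *\<^sub>R \<nu>) R" by blast
      then show ?thesis
        using mem_tangent_cball_iff[OF \<nu>(1), of R x "y - x"] r
        by (intro exI[of _ "y - x"]) (auto simp: dist_norm norm_minus_commute)
    qed
    then obtain v where v: "\<And>k. x + v k \<in> S" "\<And>k. norm (v k) < 1 / real (Suc k)"
      "\<And>k. (norm (v k))\<^sup>2 + 2 * R * (\<nu> \<bullet> v k) > 0" by metis
    have v0: "v k \<noteq> 0" for k using v(3)[of k] by auto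
    have vlim: "v \<longlonglongrightarrow> 0"
    proof (rule Lim_null_comparison)
      show "eventually (\<lambda>k. norm (v k) \<le> 1 / real (Suc k)) sequentially"
        by (intro always_eventually allI less_imp_le v(2))
      show "(\<lambda>k. 1 / real (Suc k)) \<longlonglongrightarrow> 0" by (rule LIMSEQ_Suc[OF lim_1_over_n])
    qed
    obtain w \<sigma> where w: "w \<in> sphere 0 1" and \<sigma>: "strict_mono (\<sigma> :: nat \<Rightarrow> nat)"
      and wlim: "((\<lambda>k. v k /\<^sub>R norm (v k)) \<circ> \<sigma>) \<longlonglongrightarrow> w"
      by (rule seq_compactE[OF compact_imp_seq_compact[OF compact_sphere],
            of "\<lambda>k. v k /\<^sub>R norm (v k)" 0 1]) (use v0 in auto)
    define u where "u = v \<circ> \<sigma>"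
    have u: "\<And>k. x + u k \<in> S" "\<And>k. u k \<noteq> 0" "u \<longlonglongrightarrow> 0" "(\<lambda>k. u k /\<^sub>R norm (u k)) \<longlonglongrightarrow> w"
      "\<And>k. (norm (u k))\<^sup>2 + 2 * R * (\<nu> \<bullet> u k) > 0"
      using v v0 LIMSEQ_subseq_LIMSEQ[OF vlim \<sigma>] wlim by (auto simp: u_def o_def)
    have w1: "norm w = 1" using w by simp
    have fd: "(f has_derivative blinfun_apply (fderiv f x)) (at x)"
      using lip by (simp add: lipschitz_derivative_on_def)
    have Fw_le: "fderiv f x w \<le> 0"
      using derivative_on_tangent_direction[OF fd fx(1) S[OF u(1)] u(2-4)] .
    have "(\<lambda>k. norm (u k) / (2 * R) + \<nu> \<bullet> (u k /\<^sub>R norm (u k))) \<longlonglongrightarrow> norm (0::'a) / (2 * R) + \<nu> \<bullet> w"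
      using r by (intro tendsto_intros u) auto
    moreover have "0 \<le> norm (u k) / (2 * R) + \<nu> \<bullet> (u k /\<^sub>R norm (u k))" for k
    proof -
      have "0 \<le> ((norm (u k))\<^sup>2 + 2 * R * (\<nu> \<bullet> u k)) / (2 * R * norm (u k))"
        using u(5)[of k] r by (intro divide_nonneg_nonneg) auto
      also have "\<dots> = norm (u k) / (2 * R) + \<nu> \<bullet> (u k /\<^sub>R norm (u k))"
        using u(2)[of k] r by (simp add: field_simps power2_eq_square)
      finally show ?thesis .
    qed
    ultimately have "0 \<le> norm (0::'a) / (2 * R) + \<nu> \<bullet> w"
      by (intro LIMSEQ_le_const) auto
    then have Fw: "fderiv f x w = 0" using Fw_le N \<nu>(2) by (simp add: mult_le_0_iff)
    have "w \<in> K" using tangent[OF u(1-4)] .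
    then have curvw: "curvature_ineq r f x w" using curv Fw by blast
    have "N / R < N / r" using N r by (simp add: divide_strict_left_mono)
    then obtain c where c: "N / R < c" "c < N / r" using dense by blast
    then have "eventually (\<lambda>t. c < fderiv f (x + t *\<^sub>R w) w / t) (at_right 0)"
      using curvw w1 by (simp add: curvature_ineq_iff N_def)
    then obtain \<tau> where \<tau>: "\<tau> > 0" "\<And>t. 0 < t \<Longrightarrow> t < \<tau> \<Longrightarrow> c < fderiv f (x + t *\<^sub>R w) w / t"
      by (auto simp: eventually_at_right_field)
    have "(\<lambda>k. norm (u k)) \<longlonglongrightarrow> norm (0::'a)" by (intro tendsto_intros u)
    then have e1: "eventually (\<lambda>k. norm (u k) < min \<tau> \<delta>) sequentially"
      using \<tau> lip(2) by (intro order_tendstoD) auto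
    have "(\<lambda>k. 2 * L * norm (u k /\<^sub>R norm (u k) - w)) \<longlonglongrightarrow> 2 * L * norm (w - w)"
      by (intro tendsto_intros u)
    then have e2: "eventually (\<lambda>k. 2 * L * norm (u k /\<^sub>R norm (u k) - w) < c - N / R) sequentially"
      using c by (intro order_tendstoD) auto
    obtain k where k: "norm (u k) < min \<tau> \<delta>" "2 * L * norm (u k /\<^sub>R norm (u k) - w) < c - N / R"
      using eventually_happens'[OF _ eventually_conj[OF e1 e2]] by auto
    define t where "t = norm (u k)"
    define y where "y = u k /\<^sub>R norm (u k)"
    have t: "t > 0" "t < \<tau>" "t < \<delta>" using k u(2) by (auto simp: t_def)
    have y: "norm y = 1" "u k = t *\<^sub>R y" using u(2)[of k] by (auto simp: y_def t_def)
    have "f x + t * fderiv f x y + (c - 2 * L * norm (y - w)) * t\<^sup>2 / 2 \<le> f (x + t *\<^sub>R y)"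
    proof (rule second_order_lower_bound[OF lip(1) t(1,3) y(1) w1 Fw])
      show "c * s \<le> fderiv f (x + s *\<^sub>R w) w" if "0 < s" "s \<le> t" for s
        using \<tau>(2)[of s] that t by (simp add: field_simps)
    qed
    also have "\<dots> \<le> 0" using S[OF u(1)[of k]] y by simp
    finally have le: "t * (N * (\<nu> \<bullet> y)) + (c - 2 * L * norm (y - w)) * t\<^sup>2 / 2 \<le> 0"
      using fx \<nu>(2) by simp
    have "t\<^sup>2 + 2 * R * (t * (\<nu> \<bullet> y)) > 0" using u(5)[of k] y t by simp
    then have "N / (2 * R) * (t\<^sup>2 + 2 * R * (t * (\<nu> \<bullet> y))) > 0" using N r by simp
    also have "N / (2 * R) * (t\<^sup>2 + 2 * R * (t * (\<nu> \<bullet> y))) = (N / R) * t\<^sup>2 / 2 + t * (N * (\<nu> \<bullet> y))"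
      using r by (simp add: field_simps)
    finally have "(c - 2 * L * norm (y - w)) * t\<^sup>2 < (N / R) * t\<^sup>2"
      using le by simp
    then have "c - 2 * L * norm (y - w) < N / R"
      by (rule mult_right_less_imp_less) simp
    then show False using k(2) by (simp add: y_def)
  qed
  then show ?thesis using \<nu> unfolding N_def by blast
qed

section \<open>From r-convexity to the curvature inequality\<close>

text \<open>Suppose that \<open>y\<close> is outside the tangent ball at \<open>p\<close> and put \<open>e = y - p\<close>. The intersection of the
  balls through \<open>p\<close> and \<open>y\<close> then contains points of the form \<open>p + \<epsilon> (e + \<kappa> \<nu>)\<close> with \<open>\<kappa>\<close> so large
  that the direction points out of \<open>{f \<le> 0}\<close>. This holds uniformly over all such balls, including
  the case that there are none.\<close>

lemma r_convex_supporting_ball: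
  fixes f :: "'a::euclidean_space \<Rightarrow> real"
  assumes r: "r > 0" and S: "r_convex r S" and p: "p \<in> S" "f p = 0"
    and der: "(f has_derivative blinfun_apply F) (at p)" and f: "\<And>y. y \<in> S \<Longrightarrow> f y \<le> 0" and y: "y \<in> S"
  shows "norm F * (norm (y - p))\<^sup>2 + 2 * r * F (y - p) \<le> 0"
proof (cases "F = 0")
  case F: False
  then obtain \<nu> where \<nu>: "norm \<nu> = 1" "\<And>h. F h = norm F * (\<nu> \<bullet> h)"
    using gradient_of_functional by blast
  have N: "norm F > 0" using F by simp
  show ?thesis
  proof (rule ccontr)
    assume no: "\<not> norm F * (norm (y - p))\<^sup>2 + 2 * r * F (y - p) \<le> 0"
    define e where "e = y - p"
    have "norm F * ((norm e)\<^sup>2 + 2 * r * (\<nu> \<bullet> e)) > 0"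
      using no \<nu>(2)[of e] unfolding e_def[symmetric] by (simp add: algebra_simps)
    then have out: "(norm e)\<^sup>2 + 2 * r * (\<nu> \<bullet> e) > 0" using N by (simp add: zero_less_mult_iff)
    then have "e \<noteq> 0" by auto
    then have e2: "(norm e)\<^sup>2 / (2 * r) > 0" using r by simp
    have "- (\<nu> \<bullet> e) < (norm e)\<^sup>2 / (2 * r)" using out r by (simp add: field_simps)
    \<comment> \<open>\<open>\<kappa>\<close> exceeds \<open>- (\<nu> \<bullet> e)\<close> to make the direction point outward, and stays below the value at which the balls through \<open>p\<close> and \<open>y\<close> could lose it\<close>
    then obtain \<kappa> where "max 0 (- (\<nu> \<bullet> e)) < \<kappa>" "\<kappa> < (norm e)\<^sup>2 / (2 * r)"
      using dense[of "max 0 (- (\<nu> \<bullet> e))" "(norm e)\<^sup>2 / (2 * r)"] e2 by auto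
    then have \<kappa>: "\<kappa> > 0" "\<kappa> + \<nu> \<bullet> e > 0" "(norm e)\<^sup>2 - 2 * \<kappa> * r > 0"
      using r by (auto simp: field_simps)
    define a where "a = e + \<kappa> *\<^sub>R \<nu>"
    have Fa: "F a > 0"
      unfolding \<nu>(2)[of a] using N \<kappa>(2) \<nu>(1)
      by (simp add: a_def inner_add_right norm_eq_1 zero_less_mult_iff add.commute)
    have a0: "a \<noteq> 0" using Fa by auto
    define \<epsilon>0 where "\<epsilon>0 = min 1 (((norm e)\<^sup>2 - 2 * \<kappa> * r) / (norm a)\<^sup>2)"
    have \<epsilon>0: "\<epsilon>0 > 0" using \<kappa>(3) a0 by (simp add: \<epsilon>0_def)
    have in_S: "p + \<epsilon> *\<^sub>R a \<in> S" if \<epsilon>: "0 < \<epsilon>" "\<epsilon> \<le> \<epsilon>0" for \<epsilon>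
    proof -
      have \<epsilon>1: "\<epsilon> \<le> 1" "\<epsilon> * (norm a)\<^sup>2 \<le> (norm e)\<^sup>2 - 2 * \<kappa> * r"
        using \<epsilon> a0 by (auto simp: \<epsilon>0_def field_simps)
      have "p + \<epsilon> *\<^sub>R a \<in> cball c r" if c: "p \<in> cball c r" "y \<in> cball c r" for c
      proof -
        define q where "q = c - p"
        have "norm q \<le> r" using c(1) by (simp add: q_def dist_norm)
        then have q1: "(norm q)\<^sup>2 \<le> r\<^sup>2" by (simp add: power_mono)
        have "norm (e - q) \<le> r" using c(2) by (simp add: q_def e_def dist_norm norm_minus_commute)
        then have "(norm (e - q))\<^sup>2 \<le> r\<^sup>2" by (simp add: power_mono)
        then have q2: "(norm e)\<^sup>2 - 2 * (e \<bullet> q) + (norm q)\<^sup>2 \<le> r\<^sup>2"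
          unfolding power2_norm_eq_inner by (simp add: inner_diff_left inner_diff_right inner_commute)
        have "\<nu> \<bullet> q \<ge> - r" using Cauchy_Schwarz_ineq2[of \<nu> q] \<nu>(1) \<open>norm q \<le> r\<close> by auto
        then have "\<kappa> * (\<nu> \<bullet> q) \<ge> \<kappa> * (- r)" using \<kappa>(1) by (intro mult_left_mono) auto
        then have aq: "2 * (a \<bullet> q) \<ge> (norm e)\<^sup>2 + (norm q)\<^sup>2 - r\<^sup>2 - 2 * \<kappa> * r"
          using q2 by (simp add: a_def inner_add_left)
        have "(norm (\<epsilon> *\<^sub>R a - q))\<^sup>2 = \<epsilon>\<^sup>2 * (norm a)\<^sup>2 - \<epsilon> * (2 * (a \<bullet> q)) + (norm q)\<^sup>2"
          unfolding power2_norm_eq_inner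
          by (simp add: inner_diff_left inner_diff_right inner_commute power2_eq_square)
        also have "\<dots> \<le> \<epsilon>\<^sup>2 * (norm a)\<^sup>2 - \<epsilon> * ((norm e)\<^sup>2 + (norm q)\<^sup>2 - r\<^sup>2 - 2 * \<kappa> * r) + (norm q)\<^sup>2"
          using aq \<epsilon>(1) by (intro add_right_mono diff_left_mono mult_left_mono) auto
        also have "\<dots> = \<epsilon> * (\<epsilon> * (norm a)\<^sup>2 - ((norm e)\<^sup>2 - 2 * \<kappa> * r)) + (1 - \<epsilon>) * (norm q)\<^sup>2 + \<epsilon> * r\<^sup>2"
          by (simp add: power2_eq_square algebra_simps)
        also have "\<dots> \<le> 0 + (1 - \<epsilon>) * r\<^sup>2 + \<epsilon> * r\<^sup>2"
          using \<epsilon>1 \<epsilon>(1) q1 by (intro add_mono mult_left_mono mult_nonneg_nonpos) auto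
        finally have "(norm (\<epsilon> *\<^sub>R a - q))\<^sup>2 \<le> r\<^sup>2" by (simp add: algebra_simps)
        then have "norm (\<epsilon> *\<^sub>R a - q) \<le> r" by (rule power2_le_imp_le) (use r in simp)
        moreover have "\<epsilon> *\<^sub>R a - q = p + \<epsilon> *\<^sub>R a - c" by (simp add: q_def)
        ultimately show ?thesis by (metis mem_cball dist_norm dist_commute)
      qed
      then have "p + \<epsilon> *\<^sub>R a \<in> \<Inter> {cball c r |c. p \<in> cball c r \<and> y \<in> cball c r}" by blast
      then show ?thesis using S p(1) y unfolding r_convex_def by blast
    qed
    define v where "v k = (\<epsilon>0 / real (Suc k)) *\<^sub>R a" for k
    have "F (a /\<^sub>R norm a) \<le> 0"
    proof (rule derivative_on_tangent_direction[OF der p(2), of v])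
      show "f (p + v k) \<le> 0" for k
        unfolding v_def using \<epsilon>0 by (intro f in_S) (auto simp: divide_le_eq)
      show "v k \<noteq> 0" for k using \<epsilon>0 a0 by (auto simp: v_def)
      have "(\<lambda>k. \<epsilon>0 * (1 / real (Suc k))) \<longlonglongrightarrow> \<epsilon>0 * 0"
        by (intro tendsto_intros LIMSEQ_Suc[OF lim_1_over_n])
      then have "(\<lambda>k. (\<epsilon>0 * (1 / real (Suc k))) *\<^sub>R a) \<longlonglongrightarrow> (\<epsilon>0 * 0) *\<^sub>R a"
        by (rule tendsto_scaleR[OF _ tendsto_const])
      then show "v \<longlonglongrightarrow> 0" by (simp add: v_def[abs_def])
      have "v k /\<^sub>R norm (v k) = a /\<^sub>R norm a" for k
        using \<epsilon>0 a0 by (simp add: v_def divide_simps)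
      then show "(\<lambda>k. v k /\<^sub>R norm (v k)) \<longlonglongrightarrow> a /\<^sub>R norm a" by simp
    qed
    then show False using Fa a0 by (simp add: blinfun.scaleR_right mult_le_0_iff field_simps)
  qed
qed simp

lemma first_order_remainder:
  assumes lip: "lipschitz_derivative_on L (ball x \<delta>) f" and v: "norm v < \<delta>"
  shows "\<bar>f (x + v) - f x - fderiv f x v\<bar> \<le> L * (norm v)\<^sup>2"
proof -
  have mem: "x + s *\<^sub>R v \<in> ball x \<delta>" if "0 \<le> s" "s \<le> 1" for s
  proof -
    have "s * norm v \<le> 1 * norm v" using that by (intro mult_right_mono) auto
    then show ?thesis using v that by (simp add: dist_norm)
  qed
  have "\<exists>z. 0 < z \<and> z < 1 \<and> f (x + 1 *\<^sub>R v) - f (x + 0 *\<^sub>R v) = (1 - 0) * fderiv f (x + z *\<^sub>R v) v"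
  proof (rule MVT2)
    fix s :: real assume "0 \<le> s" "s \<le> 1"
    then show "((\<lambda>s. f (x + s *\<^sub>R v)) has_real_derivative fderiv f (x + s *\<^sub>R v) v) (at s)"
      using lip mem by (intro DERIV_along_line) (auto simp: lipschitz_derivative_on_def)
  qed simp
  then obtain z where z: "0 < z" "z < 1" "f (x + v) - f x = fderiv f (x + z *\<^sub>R v) v" by auto
  have L: "L \<ge> 0" using lip by (simp add: lipschitz_derivative_on_def)
  have "\<bar>fderiv f (x + z *\<^sub>R v) v - fderiv f x v\<bar> \<le> L * norm (z *\<^sub>R v) * norm v"
    using lipschitz_derivative_apply[OF lip mem mem[of 0], of z v] z by simp
  also have "\<dots> = z * (L * (norm v)\<^sup>2)" using z by (simp add: power2_eq_square)
  also have "\<dots> \<le> 1 * (L * (norm v)\<^sup>2)" using z L by (intro mult_right_mono) auto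
  finally show ?thesis using z(3) by simp
qed

text \<open>For small \<open>t\<close> the intermediate value theorem on the normal through \<open>x + t h\<close> yields a zero
  \<open>x + v\<close> of \<open>f\<close> with \<open>v = t h + \<tau> \<nu>\<close> and \<open>\<tau> = O(t\<^sup>2)\<close>. The tangent balls at \<open>x\<close> and at \<open>x + v\<close> each
  contribute about \<open>N \<parallel>v\<parallel>\<^sup>2 / (2 r)\<close> to the lower bound for \<open>t f'(x + v) h\<close>: the first through
  the size of \<open>- \<tau>\<close>, the second directly. After division by \<open>t\<^sup>2\<close>, \<open>b t\<close> is the result together
  with its errors of order \<open>t\<close>.\<close>

lemma curvature_ineq_if_r_convex:
  fixes f :: "'a::euclidean_space \<Rightarrow> real"
  assumes r: "r > 0" and S: "r_convex r S" and x: "x \<in> S" "f x = 0"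
    and lip: "lipschitz_derivative_on L (ball x \<delta>) f" "\<delta> > 0" and F0: "fderiv f x \<noteq> 0"
    and f: "\<And>y. y \<in> S \<Longrightarrow> f y \<le> 0" and h: "fderiv f x h = 0"
    and near: "\<eta> > 0" "\<And>t w. 0 < t \<Longrightarrow> t < \<eta> \<Longrightarrow> norm (w - h) < \<eta> \<Longrightarrow> f (x + t *\<^sub>R w) = 0 \<Longrightarrow> x + t *\<^sub>R w \<in> S"
  shows "curvature_ineq r f x h"
proof -
  define N where "N = norm (fderiv f x)"
  have N: "N > 0" using F0 by (simp add: N_def)
  obtain \<nu> where \<nu>: "norm \<nu> = 1" "\<And>h. fderiv f x h = N * (\<nu> \<bullet> h)"
    using gradient_of_functional[OF F0] unfolding N_def by blast
  have \<nu>h: "\<nu> \<bullet> h = 0" using h N \<nu>(2)[of h] by simp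
  have L: "L \<ge> 0" using lip by (simp add: lipschitz_derivative_on_def)
  define M where "M = norm h + 1"
  \<comment> \<open>at height \<open>K t\<^sup>2\<close> above or below \<open>x + t h\<close> the linear term of \<open>f\<close> outweighs the remainder \<open>L (t M)\<^sup>2\<close>\<close>
  define K where "K = L * M\<^sup>2 / N + 1"
  have M: "M > 0" by (simp add: M_def add_nonneg_pos)
  have K: "K \<ge> 1" using L N by (simp add: K_def)
  define b where "b t = (N - L * (t * M)) * (norm h)\<^sup>2 / r - L * K * t * norm h" for t
  define t0 where "t0 = min (min (\<delta> / M) (1 / K)) (min (\<eta> / K) (min \<eta> (N / (L * M + 1))))"
  have t0: "t0 > 0" using lip(2) M K near(1) N L by (auto simp: t0_def add_nonneg_pos)
  have bound: "b t \<le> fderiv f (x + t *\<^sub>R h) h / t" if t: "0 < t" "t < t0" for t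
  proof -
    have t\<delta>: "t * M < \<delta>" and tK: "K * t < 1" "K * t < \<eta>" and t\<eta>: "t < \<eta>"
      using t M K by (auto simp: t0_def field_simps)
    have LMp: "L * M + 1 > 0" using L M by (simp add: add_nonneg_pos)
    have "t * (L * M + 1) < N" using t LMp by (auto simp: t0_def field_simps)
    moreover have "L * (t * M) \<le> t * (L * M + 1)" using t by (simp add: algebra_simps)
    ultimately have tN: "L * (t * M) < N" by linarith
    have nv: "norm (t *\<^sub>R h + \<tau> *\<^sub>R \<nu>) \<le> t * M" if "\<bar>\<tau>\<bar> \<le> K * t\<^sup>2" for \<tau>
    proof -
      have "\<bar>\<tau>\<bar> \<le> (K * t) * t" using that by (simp add: power2_eq_square)
      also have "\<dots> \<le> 1 * t" using tK t by (intro mult_right_mono) auto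
      finally have "\<bar>\<tau>\<bar> \<le> t" by simp
      then show ?thesis using norm_triangle_ineq[of "t *\<^sub>R h" "\<tau> *\<^sub>R \<nu>"] \<nu>(1) t
        by (simp add: M_def algebra_simps)
    qed
    have mem: "x + (t *\<^sub>R h + \<tau> *\<^sub>R \<nu>) \<in> ball x \<delta>" if "\<bar>\<tau>\<bar> \<le> K * t\<^sup>2" for \<tau>
    proof -
      have "dist x (x + (t *\<^sub>R h + \<tau> *\<^sub>R \<nu>)) = norm (t *\<^sub>R h + \<tau> *\<^sub>R \<nu>)"
        by (subst dist_commute) (simp add: dist_norm)
      then show ?thesis using nv[OF that] t\<delta> by simp
    qed
    have rem: "\<bar>f (x + (t *\<^sub>R h + \<tau> *\<^sub>R \<nu>)) - \<tau> * N\<bar> < N * (K * t\<^sup>2)" if "\<bar>\<tau>\<bar> \<le> K * t\<^sup>2" for \<tau>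
    proof -
      define v where "v = t *\<^sub>R h + \<tau> *\<^sub>R \<nu>"
      have Fv: "fderiv f x v = \<tau> * N"
        using \<nu> \<nu>h by (simp add: v_def inner_add_right norm_eq_1)
      have "\<bar>f (x + v) - \<tau> * N\<bar> \<le> L * (norm v)\<^sup>2"
        using first_order_remainder[OF lip(1), of v] nv[OF that] t\<delta> x(2) by (simp add: v_def[symmetric] Fv)
      also have "\<dots> \<le> L * (t * M)\<^sup>2"
        using nv[OF that] L by (intro mult_left_mono power_mono) (auto simp: v_def)
      also have "\<dots> < N * (K * t\<^sup>2)" using N t by (simp add: K_def field_simps power_mult_distrib)
      finally show ?thesis by (simp add: v_def)
    qed
    have "\<exists>\<tau>\<ge>- (K * t\<^sup>2). \<tau> \<le> K * t\<^sup>2 \<and> f (x + (t *\<^sub>R h + \<tau> *\<^sub>R \<nu>)) = 0"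
    proof (rule IVT')
      show "f (x + (t *\<^sub>R h + (- (K * t\<^sup>2)) *\<^sub>R \<nu>)) \<le> 0"
        using rem[of "- (K * t\<^sup>2)"] K by (simp add: mult.commute)
      show "0 \<le> f (x + (t *\<^sub>R h + (K * t\<^sup>2) *\<^sub>R \<nu>))"
        using rem[of "K * t\<^sup>2"] K by (simp add: mult.commute)
      show "- (K * t\<^sup>2) \<le> K * t\<^sup>2" using K by simp
      have cf: "continuous_on (ball x \<delta>) f"
        using lip by (intro continuous_at_imp_continuous_on ballI has_derivative_continuous)
          (auto simp: lipschitz_derivative_on_def)
      show "continuous_on {- (K * t\<^sup>2)..K * t\<^sup>2} (\<lambda>\<tau>. f (x + (t *\<^sub>R h + \<tau> *\<^sub>R \<nu>)))"
        by (rule continuous_on_compose2[OF cf]) (auto intro!: continuous_intros mem[unfolded mem_ball] simp: abs_le_iff)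
    qed
    then obtain \<tau> where \<tau>: "\<bar>\<tau>\<bar> \<le> K * t\<^sup>2" "f (x + (t *\<^sub>R h + \<tau> *\<^sub>R \<nu>)) = 0"
      by (metis abs_le_iff minus_le_iff)
    define v where "v = t *\<^sub>R h + \<tau> *\<^sub>R \<nu>"
    have v: "f (x + v) = 0" "norm v \<le> t * M" "x + v \<in> ball x \<delta>"
      using \<tau> nv[OF \<tau>(1)] mem[OF \<tau>(1)] by (auto simp: v_def)
    have vS: "x + v \<in> S"
    proof -
      have w: "v = t *\<^sub>R (h + (\<tau> / t) *\<^sub>R \<nu>)" using t by (simp add: v_def algebra_simps)
      have "\<bar>\<tau>\<bar> \<le> (K * t) * t" using \<tau>(1) by (simp add: power2_eq_square)
      then have "\<bar>\<tau> / t\<bar> \<le> K * t" using t by (simp add: abs_divide divide_le_eq)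
      then have "norm (h + (\<tau> / t) *\<^sub>R \<nu> - h) < \<eta>" using tK \<nu>(1) by simp
      then show ?thesis using near(2)[OF t(1) t\<eta>] v(1) unfolding w by blast
    qed
    define F where "F = fderiv f x"
    define G where "G = fderiv f (x + v)"
    have xb: "x \<in> ball x \<delta>" using lip(2) by simp
    have der: "(f has_derivative blinfun_apply F) (at x)" "(f has_derivative blinfun_apply G) (at (x + v))"
      using lip v(3) by (auto simp: lipschitz_derivative_on_def F_def G_def)
    have "N * (norm v)\<^sup>2 + 2 * r * F v \<le> 0"
      using r_convex_supporting_ball[OF r S x der(1) f vS] by (simp add: N_def F_def)
    moreover have "F v = N * \<tau>" using \<nu> \<nu>h by (simp add: F_def v_def inner_add_right norm_eq_1)
    ultimately have "N * ((norm v)\<^sup>2 + 2 * r * \<tau>) \<le> 0" by (simp add: algebra_simps)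
    then have "(norm v)\<^sup>2 + 2 * r * \<tau> \<le> 0" using N by (simp add: mult_le_0_iff)
    then have \<tau>le: "- \<tau> \<ge> (norm v)\<^sup>2 / (2 * r)" using r by (simp add: field_simps)
    have "norm G * (norm v)\<^sup>2 + 2 * r * G (- v) \<le> 0"
      using r_convex_supporting_ball[OF r S vS v(1) der(2) f x(1)] by simp
    then have Gv: "G v \<ge> norm G * ((norm v)\<^sup>2 / (2 * r))"
      using r by (simp add: blinfun.minus_right field_simps)
    have "norm (G - F) \<le> L * norm v"
      using lip(1) v(3) xb unfolding lipschitz_derivative_on_def F_def G_def
      by (metis add_diff_cancel_left')
    also have "\<dots> \<le> L * (t * M)" using L v(2) by (intro mult_left_mono) auto
    finally have GF: "norm (G - F) \<le> L * (t * M)" .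
    have nG: "norm G \<ge> N - L * (t * M)"
      using norm_triangle_ineq2[of F G] GF by (simp add: N_def F_def norm_minus_commute)
    have "\<bar>G \<nu> - F \<nu>\<bar> \<le> L * (t * M)"
      using norm_blinfun[of "G - F" \<nu>] \<nu>(1) GF by (simp add: blinfun.diff_left)
    moreover have "F \<nu> = N" using \<nu> by (simp add: F_def norm_eq_1)
    ultimately have G\<nu>: "G \<nu> \<ge> N - L * (t * M)" by simp
    define Q where "Q = (norm v)\<^sup>2 / (2 * r)"
    have Q0: "Q \<ge> 0" using r by (simp add: Q_def)
    have "(N - L * (t * M)) * Q \<le> norm G * Q" using nG Q0 by (rule mult_right_mono)
    moreover have "Q * (N - L * (t * M)) \<le> (- \<tau>) * G \<nu>"
      using \<tau>le G\<nu> Q0 tN by (intro mult_mono) (auto simp: Q_def)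
    moreover have "G v = t * G h + \<tau> * G \<nu>" by (simp add: v_def blinfun.add_right blinfun.scaleR_right)
    ultimately have "t * G h \<ge> (N - L * (t * M)) * (2 * Q)"
      using Gv[folded Q_def] by (simp add: algebra_simps)
    moreover have "2 * Q \<ge> t\<^sup>2 * (norm h)\<^sup>2 / r"
    proof -
      have "(norm v)\<^sup>2 = (t * norm h)\<^sup>2 + \<tau>\<^sup>2"
        unfolding power2_norm_eq_inner power_mult_distrib v_def using \<nu>h \<nu>(1)
        by (simp add: inner_add_left inner_add_right inner_commute[of h \<nu>] norm_eq_1 power2_eq_square)
      then have "(norm v)\<^sup>2 \<ge> (t * norm h)\<^sup>2" by simp
      then show ?thesis using r by (simp add: Q_def divide_right_mono power_mult_distrib)
    qed
    then have "(N - L * (t * M)) * (t\<^sup>2 * (norm h)\<^sup>2 / r) \<le> (N - L * (t * M)) * (2 * Q)"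
      using tN by (intro mult_left_mono) auto
    ultimately have "t * ((N - L * (t * M)) * (norm h)\<^sup>2 / r * t) \<le> t * G h"
      by (simp add: power2_eq_square algebra_simps)
    then have Gh: "(N - L * (t * M)) * (norm h)\<^sup>2 / r * t \<le> G h"
      by (rule mult_left_le_imp_le[OF _ t(1)])
    have thb: "x + t *\<^sub>R h \<in> ball x \<delta>" using mem[of 0] K by simp
    have "\<bar>G h - fderiv f (x + t *\<^sub>R h) h\<bar> \<le> L * norm (\<tau> *\<^sub>R \<nu>) * norm h"
      using lipschitz_derivative_apply[OF lip(1) v(3) thb, of h] by (simp add: G_def v_def)
    also have "\<dots> \<le> L * (K * t\<^sup>2) * norm h"
      using \<tau>(1) \<nu>(1) L by (intro mult_right_mono mult_left_mono) auto
    finally have "fderiv f (x + t *\<^sub>R h) h \<ge> b t * t"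
      using Gh by (simp add: b_def algebra_simps power2_eq_square)
    then show ?thesis using t by (simp add: pos_le_divide_eq)
  qed
  show ?thesis
    unfolding curvature_ineq_iff
  proof (intro allI impI)
    fix c assume c: "c < 1 / r * norm (fderiv f x) * (norm h)\<^sup>2"
    have "(b \<longlongrightarrow> b 0) (at_right 0)" unfolding b_def using r by (intro tendsto_intros) auto
    moreover have "c < b 0" using c by (simp add: b_def N_def)
    ultimately have "eventually (\<lambda>t. c < b t) (at_right 0)" by (rule order_tendstoD(1))
    moreover have "eventually (\<lambda>t. b t \<le> fderiv f (x + t *\<^sub>R h) h / t) (at_right 0)"
      using bound t0 by (auto simp: eventually_at_right_field)
    ultimately show "eventually (\<lambda>t. c < fderiv f (x + t *\<^sub>R h) h / t) (at_right 0)"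
      by eventually_elim simp
  qed
qed

text \<open>On the kernel of the derivative the difference quotients \<open>f'(x + t h) h / t\<close> depend on \<open>h\<close> in a
  locally Lipschitz way, uniformly in \<open>t\<close>, so the lower bounds for the directions \<open>h + \<epsilon> k\<close> pass
  to the limit \<open>\<epsilon> \<rightarrow> 0\<close>.\<close>

lemma curvature_ineq_limit:
  fixes f :: "'a::real_normed_vector \<Rightarrow> real"
  assumes lip: "lipschitz_derivative_on L (ball x \<delta>) f" "\<delta> > 0"
    and h: "fderiv f x h = 0" "fderiv f x k = 0"
    and curv: "\<And>\<epsilon>. 0 < \<epsilon> \<Longrightarrow> curvature_ineq r f x (h + \<epsilon> *\<^sub>R k)"
  shows "curvature_ineq r f x h"
  unfolding curvature_ineq_iff
proof (intro allI impI)
  fix c assume c: "c < 1 / r * norm (fderiv f x) * (norm h)\<^sup>2"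
  define e where "e \<epsilon> = L * (\<epsilon> * norm k) * (norm h + norm (h + \<epsilon> *\<^sub>R k))" for \<epsilon>
  define B where "B \<epsilon> = 1 / r * norm (fderiv f x) * (norm (h + \<epsilon> *\<^sub>R k))\<^sup>2 - e \<epsilon>" for \<epsilon>
  have "(B \<longlongrightarrow> B 0) (at_right 0)" unfolding B_def e_def by (intro tendsto_intros)
  moreover have "c < B 0" using c by (simp add: B_def e_def)
  ultimately have "eventually (\<lambda>\<epsilon>. c < B \<epsilon>) (at_right 0)" by (rule order_tendstoD(1))
  then obtain \<epsilon>0 where "\<epsilon>0 > 0" "\<And>\<epsilon>. 0 < \<epsilon> \<Longrightarrow> \<epsilon> < \<epsilon>0 \<Longrightarrow> c < B \<epsilon>"
    by (auto simp: eventually_at_right_field)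
  then obtain \<epsilon> where \<epsilon>: "\<epsilon> > 0" "c < B \<epsilon>" using dense by blast
  define w where "w = h + \<epsilon> *\<^sub>R k"
  have ev1: "eventually (\<lambda>t. c + e \<epsilon> < fderiv f (x + t *\<^sub>R w) w / t) (at_right 0)"
    using curv[OF \<epsilon>(1)] \<epsilon>(2) unfolding curvature_ineq_iff w_def[symmetric] by (simp add: B_def w_def)
  have inb: "eventually (\<lambda>t. x + t *\<^sub>R y \<in> ball x \<delta>) (at_right 0)" for y
  proof -
    have "((\<lambda>t. dist x (x + t *\<^sub>R y)) \<longlongrightarrow> dist x (x + 0 *\<^sub>R y)) (at_right 0)"
      by (intro tendsto_intros)
    then have "eventually (\<lambda>t. dist x (x + t *\<^sub>R y) < \<delta>) (at_right 0)"
      using lip(2) by (intro order_tendstoD(2)) auto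
    then show ?thesis by simp
  qed
  have pos: "eventually (\<lambda>t. t > (0::real)) (at_right 0)" by (rule eventually_at_right_less)
  show "eventually (\<lambda>t. c < fderiv f (x + t *\<^sub>R h) h / t) (at_right 0)"
    using ev1 inb[of h] inb[of w] pos
  proof eventually_elim
    case (elim t)
    have xb: "x \<in> ball x \<delta>" using lip(2) by simp
    have hw: "h - w = - (\<epsilon> *\<^sub>R k)" "norm (h - w) = \<epsilon> * norm k" using \<epsilon> by (simp_all add: w_def)
    have "\<bar>fderiv f (x + t *\<^sub>R h) h - fderiv f (x + t *\<^sub>R w) h\<bar> \<le> L * (t * norm (h - w)) * norm h"
      using lipschitz_derivative_apply[OF lip(1) elim(2,3), of h] elim(4)
      by (simp add: scaleR_diff_right[symmetric])
    moreover have "\<bar>fderiv f (x + t *\<^sub>R w) (h - w) - fderiv f x (h - w)\<bar> \<le> L * (t * norm w) * norm (h - w)"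
      using lipschitz_derivative_apply[OF lip(1) elim(3) xb, of "h - w"] elim(4) by simp
    moreover have "fderiv f x (h - w) = 0" using h by (simp add: hw blinfun.minus_right blinfun.scaleR_right)
    moreover have "fderiv f (x + t *\<^sub>R w) (h - w) = fderiv f (x + t *\<^sub>R w) h - fderiv f (x + t *\<^sub>R w) w"
      by (simp add: blinfun.diff_right)
    moreover have "L * (t * norm (h - w)) * norm h + L * (t * norm w) * norm (h - w) = t * e \<epsilon>"
      using \<epsilon>(1) unfolding hw(2) by (simp add: e_def w_def[symmetric] algebra_simps)
    ultimately have "fderiv f (x + t *\<^sub>R h) h \<ge> fderiv f (x + t *\<^sub>R w) w - t * e \<epsilon>" by linarith
    moreover have "(c + e \<epsilon>) * t < fderiv f (x + t *\<^sub>R w) w"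
      using elim(1,4) by (simp add: pos_less_divide_eq)
    ultimately have "c * t < fderiv f (x + t *\<^sub>R h) h" by (simp add: algebra_simps)
    then show ?case using elim(4) by (simp add: pos_less_divide_eq)
  qed
qed

text \<open>The gradients form an independent set without repetitions, so a linear functional can be
  prescribed on them; it is the inner product with the solution.\<close>

lemma lin_indep_family_solve:
  fixes F :: "'i \<Rightarrow> ('a::euclidean_space \<Rightarrow>\<^sub>L real)"
  assumes "finite I" "lin_indep_family I F"
  obtains k where "\<And>i. i \<in> I \<Longrightarrow> F i k = y i"
proof -
  have ex: "\<exists>G. \<forall>h. F i h = G \<bullet> h" for i
    using blinfun_eq_inner[of "F i"] by blast
  define G where "G i = (SOME G. \<forall>h. F i h = G \<bullet> h)" for i
  have G: "F i h = G i \<bullet> h" for i h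
    using someI_ex[OF ex[of i]] unfolding G_def by blast
  have zero: "c i = 0" if "(\<Sum>i\<in>I. c i *\<^sub>R G i) = 0" "i \<in> I" for c i
  proof -
    have "(\<Sum>i\<in>I. c i *\<^sub>R F i) = 0"
    proof (rule blinfun_eqI)
      fix h
      have "blinfun_apply (\<Sum>i\<in>I. c i *\<^sub>R F i) h = (\<Sum>i\<in>I. c i *\<^sub>R G i) \<bullet> h"
        by (simp add: blinfun.sum_left blinfun.scaleR_left G inner_sum_left)
      then show "blinfun_apply (\<Sum>i\<in>I. c i *\<^sub>R F i) h = blinfun_apply 0 h" using that(1) by simp
    qed
    then show ?thesis using assms(2) that(2) unfolding lin_indep_family_def by blast
  qed
  have inj: "inj_on G I"
  proof (rule inj_onI, rule ccontr)
    fix i j assume ij: "i \<in> I" "j \<in> I" "G i = G j" "i \<noteq> j"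
    define c where "c l = (if l = i then 1 else 0) - (if l = j then 1 else (0::real))" for l
    have "(\<Sum>l\<in>I. c l *\<^sub>R G l) = (\<Sum>l\<in>I. (if l = i then G i else 0) - (if l = j then G j else 0))"
      by (intro sum.cong) (auto simp: c_def)
    also have "\<dots> = 0" using ij assms(1) by (simp add: sum_subtractf)
    finally have "c i = 0" using zero ij(1) by blast
    then show False using ij(4) by (simp add: c_def)
  qed
  have "independent (G ` I)"
  proof (rule independent_if_scalars_zero)
    show "finite (G ` I)" using assms(1) by simp
    fix c v assume c: "(\<Sum>x\<in>G ` I. c x *\<^sub>R x) = 0" "v \<in> G ` I"
    then have "(\<Sum>i\<in>I. c (G i) *\<^sub>R G i) = 0" by (simp add: sum.reindex[OF inj])
    then show "c v = 0" using zero[of "\<lambda>i. c (G i)"] c(2) by blast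
  qed
  from linear_independent_extend[OF this, of "\<lambda>v. y (the_inv_into I G v)"]
  obtain \<phi> where \<phi>: "linear \<phi>" "\<And>v. v \<in> G ` I \<Longrightarrow> \<phi> v = y (the_inv_into I G v)"
    by blast
  define k where "k = (\<Sum>b\<in>Basis. \<phi> b *\<^sub>R b)"
  have "\<phi> v = v \<bullet> k" for v
  proof -
    have "\<phi> v = \<phi> (\<Sum>b\<in>Basis. (v \<bullet> b) *\<^sub>R b)" by (simp add: euclidean_representation)
    also have "\<dots> = (\<Sum>b\<in>Basis. (v \<bullet> b) * \<phi> b)"
      using \<phi>(1) by (simp add: linear_sum linear_scale)
    also have "\<dots> = v \<bullet> k" by (simp add: k_def inner_sum_right mult.commute)
    finally show ?thesis .
  qed
  then have "F i k = y i" if "i \<in> I" for i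
    using \<phi>(2)[of "G i"] that by (simp add: G the_inv_into_f_f[OF inj])
  then show ?thesis using that by blast
qed

lemma negative_on_cone:
  fixes f :: "'a::real_normed_vector \<Rightarrow> real"
  assumes "(f has_derivative blinfun_apply F) (at x)" "f x = 0" "F h < 0"
  shows "\<exists>e>0. \<forall>t w. 0 < t \<and> t < e \<and> norm (w - h) < e \<longrightarrow> f (x + t *\<^sub>R w) < 0"
proof -
  define M where "M = norm h + 1"
  have M: "M > 0" by (simp add: M_def add_nonneg_pos)
  have \<epsilon>: "- F h / (4 * M) > 0" using assms(3) M by (simp add: divide_neg_pos)
  obtain d where d: "d > 0" "\<And>y. norm (y - x) < d \<Longrightarrow>
      norm (f y - f x - F (y - x)) \<le> - F h / (4 * M) * norm (y - x)"
    using assms(1) \<epsilon> unfolding has_derivative_at_alt by blast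
  define P where "P = 2 * (norm F + 1)"
  have P: "P > 0" by (simp add: P_def add_nonneg_pos)
  define e where "e = min (min 1 (d / M)) (- F h / P)"
  have e: "e > 0" using assms(3) d(1) M P by (simp add: e_def divide_neg_pos)
  show ?thesis
  proof (intro exI[of _ e] conjI e allI impI)
    fix t w assume tw: "0 < t \<and> t < e \<and> norm (w - h) < e"
    then have t: "0 < t" "t < d / M" and w: "norm (w - h) < 1" "norm (w - h) < - F h / P"
      by (auto simp: e_def)
    have wM: "norm w \<le> M" using norm_triangle_ineq2[of w h] w(1) by (simp add: M_def)
    then have "t * norm w \<le> t * M" using t by (intro mult_left_mono) auto
    also have "\<dots> < d" using t(2) M by (simp add: field_simps)
    finally have "norm (f (x + t *\<^sub>R w) - f x - F (t *\<^sub>R w)) \<le> - F h / (4 * M) * (t * norm w)"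
      using d(2)[of "x + t *\<^sub>R w"] t by simp
    also have "\<dots> \<le> - F h / (4 * M) * (t * M)"
      using \<epsilon> wM t by (intro mult_left_mono) auto
    also have "\<dots> = t * (- F h) / 4" using M by simp
    finally have 1: "f (x + t *\<^sub>R w) \<le> t * F w + t * (- F h) / 4"
      using assms(2) by (simp add: blinfun.scaleR_right)
    have "\<bar>F (w - h)\<bar> \<le> norm F * norm (w - h)" using norm_blinfun[of F "w - h"] by simp
    also have "\<dots> \<le> (P / 2) * norm (w - h)" by (intro mult_right_mono) (auto simp: P_def)
    also have "\<dots> < - F h / 2" using w(2) P by (simp add: field_simps)
    finally have "F w < F h / 2" by (simp add: blinfun.diff_right)
    then have "t * F w < t * (F h / 2)" using t(1) by simp
    then have "f (x + t *\<^sub>R w) < t * (F h / 2) + t * (- F h) / 4" using 1 by linarith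
    also have "\<dots> = t * F h / 4" by simp
    also have "\<dots> < 0" using t assms(3) by (simp add: mult_pos_neg)
    finally show "f (x + t *\<^sub>R w) < 0" .
  qed
qed

section \<open>Systems of inequalities\<close>

lemma eventually_negative:
  fixes U :: "'a::real_normed_vector set"
  assumes "open U" "continuous_on U f" "z \<in> U" "f z < (0::real)"
  shows "eventually (\<lambda>y. f y < 0) (nhds z)"
proof -
  have "isCont f z" using assms by (simp add: continuous_on_eq_continuous_at)
  then have "(f \<longlongrightarrow> f z) (nhds z)"
    by (simp add: isCont_def tendsto_at_iff_tendsto_nhds)
  then show ?thesis using assms(4) by (rule order_tendstoD(2))
qed

lemma eventually_inactive_negative:
  fixes U :: "'a::real_normed_vector set"
  assumes "open U" "\<forall>i\<in>{1..m}. continuous_on U (g i)" "x \<in> feasible_set U m g"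
  shows "eventually (\<lambda>y. y \<in> U \<and> (\<forall>j\<in>{1..m} - active m g x. g j y < 0)) (nhds x)"
proof (intro eventually_conj eventually_ball_finite ballI)
  have xU: "x \<in> U" using assms(3) by (simp add: feasible_set_def)
  show "eventually (\<lambda>y. y \<in> U) (nhds x)" using assms(1) xU by (simp add: eventually_nhds_in_open)
  fix j assume j: "j \<in> {1..m} - active m g x"
  have "g j x < 0" using assms(3) j by (auto simp: feasible_set_def active_def order_less_le)
  then show "eventually (\<lambda>y. g j y < 0) (nhds x)"
    using assms(1,2) xU j by (intro eventually_negative[of U]) auto
qed auto

lemma strictly_feasible_in_interior:
  fixes U :: "'a::real_normed_vector set"
  assumes "open U" "\<forall>i\<in>{1..m}. continuous_on U (g i)" "z \<in> U" "\<forall>i\<in>{1..m}. g i z < 0"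
  shows "z \<in> interior (feasible_set U m g)"
proof -
  have "eventually (\<lambda>y. y \<in> U \<and> (\<forall>i\<in>{1..m}. g i y < 0)) (nhds z)"
    using assms by (intro eventually_conj eventually_ball_finite ballI eventually_negative[of U])
      (auto simp: eventually_nhds_in_open)
  then obtain W where "open W" "z \<in> W" "\<forall>y\<in>W. y \<in> U \<and> (\<forall>i\<in>{1..m}. g i y < 0)"
    unfolding eventually_nhds by blast
  then show ?thesis
    by (intro interiorI[of W]) (auto simp: feasible_set_def less_imp_le)
qed

lemma active_nonempty_at_frontier:
  fixes U :: "'a::real_normed_vector set"
  assumes "open U" "\<forall>i\<in>{1..m}. continuous_on U (g i)" "x \<in> feasible_set U m g"
    "x \<in> frontier (feasible_set U m g)"
  shows "active m g x \<noteq> {}"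
proof
  assume "active m g x = {}"
  then have "\<forall>i\<in>{1..m}. g i x < 0"
    using assms(3) by (force simp: active_def feasible_set_def order_less_le)
  then have "x \<in> interior (feasible_set U m g)"
    using assms by (intro strictly_feasible_in_interior) (auto simp: feasible_set_def)
  then show False using assms(4) by (simp add: frontier_def)
qed

lemma activeE:
  assumes "\<forall>i\<in>{1..m}. C11_submersion_on_zero_set U (g i)" "x \<in> feasible_set U m g" "j \<in> active m g x"
  obtains \<delta> L where "\<delta> > 0" "lipschitz_derivative_on L (ball x \<delta>) (g j)" "fderiv (g j) x \<noteq> 0"
    "(g j has_derivative blinfun_apply (fderiv (g j) x)) (at x)" "j \<in> {1..m}" "g j x = 0"
proof -
  have j: "j \<in> {1..m}" "g j x = 0" using assms(3) by (auto simp: active_def)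
  have sub: "C11_submersion_on_zero_set U (g j)" using assms(1) j(1) by blast
  have "x \<in> U" using assms(2) by (simp add: feasible_set_def)
  then obtain \<delta> L where \<delta>: "\<delta> > 0" "lipschitz_derivative_on L (ball x \<delta>) (g j)" "fderiv (g j) x \<noteq> 0"
    using C11_submersionE[OF sub _ j(2)] by blast
  then have "(g j has_derivative blinfun_apply (fderiv (g j) x)) (at x)"
    by (simp add: lipschitz_derivative_on_def)
  then show ?thesis using that \<delta> j by blast
qed

text \<open>Near \<open>x\<close> all active constraints decrease strictly along \<open>d\<close>, from every feasible starting point,
  and the other constraints stay negative.\<close>

lemma inward_at_feasible_set:
  fixes x :: "'a::real_normed_vector"
  assumes "open U" "\<forall>i\<in>{1..m}. continuous_on U (g i) \<and> C11_submersion_on_zero_set U (g i)"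
    "x \<in> feasible_set U m g" and d: "\<forall>j\<in>active m g x. fderiv (g j) x d < 0"
  shows "inward_at (feasible_set U m g) x"
proof -
  have cont: "\<forall>i\<in>{1..m}. continuous_on U (g i)"
    and sub: "\<forall>i\<in>{1..m}. C11_submersion_on_zero_set U (g i)" using assms(2) by simp_all
  define P where "P j y \<longleftrightarrow> (g j has_derivative blinfun_apply (fderiv (g j) y)) (at y) \<and> fderiv (g j) y d < 0"
    for j y
  have "eventually (P j) (nhds x)" if j: "j \<in> active m g x" for j
  proof -
    obtain \<delta> L where \<delta>: "\<delta> > 0" "lipschitz_derivative_on L (ball x \<delta>) (g j)"
      using activeE[OF sub assms(3) j] by blast
    have "((\<lambda>y. fderiv (g j) x d + L * norm (y - x) * norm d) \<longlongrightarrow> fderiv (g j) x d + L * norm (x - x) * norm d) (nhds x)"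
      by (intro tendsto_intros filterlim_ident)
    then have "eventually (\<lambda>y. fderiv (g j) x d + L * norm (y - x) * norm d < 0) (nhds x)"
      using d j by (intro order_tendstoD(2)) auto
    moreover have "eventually (\<lambda>y. y \<in> ball x \<delta>) (nhds x)"
      using \<delta>(1) by (intro eventually_nhds_in_open) auto
    ultimately show ?thesis
    proof eventually_elim
      case (elim y)
      have "\<bar>fderiv (g j) y d - fderiv (g j) x d\<bar> \<le> L * norm (y - x) * norm d"
        using lipschitz_derivative_apply[OF \<delta>(2) elim(2), of x d] \<delta>(1) by simp
      then show "P j y" using elim \<delta>(2) unfolding P_def lipschitz_derivative_on_def by auto
    qed
  qed
  moreover have "finite (active m g x)" by (simp add: active_def)
  ultimately have "eventually (\<lambda>y. \<forall>j\<in>active m g x. P j y) (nhds x)"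
    by (intro eventually_ball_finite) auto
  then have "eventually (\<lambda>y. (\<forall>j\<in>active m g x. P j y) \<and> y \<in> U \<and> (\<forall>j\<in>{1..m} - active m g x. g j y < 0)) (nhds x)"
    using eventually_inactive_negative[OF assms(1) cont assms(3)] by (rule eventually_conj)
  then obtain \<delta> where \<delta>: "\<delta> > 0" and P: "\<And>y j. y \<in> ball x \<delta> \<Longrightarrow> j \<in> active m g x \<Longrightarrow> P j y"
    and U: "\<And>y. y \<in> ball x \<delta> \<Longrightarrow> y \<in> U"
    and inact: "\<And>y j. y \<in> ball x \<delta> \<Longrightarrow> j \<in> {1..m} - active m g x \<Longrightarrow> g j y < 0"
    unfolding eventually_nhds_metric by (auto simp: dist_commute)
  define \<epsilon> where "\<epsilon> = min (\<delta> / 2) (\<delta> / (2 * (norm d + 1)))"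
  have nd: "norm d + 1 > 0" by (simp add: add_nonneg_pos)
  have \<epsilon>: "\<epsilon> > 0" "\<epsilon> \<le> \<delta> / 2"
    using \<delta> nd by (simp add: \<epsilon>_def) (unfold \<epsilon>_def, rule min.cobounded1)
  have "\<epsilon> \<le> \<delta> / (2 * (norm d + 1))" by (simp add: \<epsilon>_def)
  then have "\<epsilon> * (norm d + 1) \<le> \<delta> / 2" using nd by (simp add: field_simps)
  then have \<epsilon>d: "\<epsilon> * norm d < \<delta> / 2" using \<epsilon>(1) by (simp add: algebra_simps)
  show ?thesis
    unfolding inward_at_def
  proof (intro exI[of _ d] exI[of _ \<epsilon>] conjI ballI allI impI \<epsilon>(1))
    fix y t assume y: "y \<in> feasible_set U m g \<inter> ball x \<epsilon>" and t: "0 < t \<and> t \<le> \<epsilon>"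
    have inb: "y + s *\<^sub>R d \<in> ball x \<delta>" if "0 \<le> s" "s \<le> t" for s
    proof -
      have "dist x (y + s *\<^sub>R d) \<le> dist x y + dist y (y + s *\<^sub>R d)" by (rule dist_triangle)
      also have "dist y (y + s *\<^sub>R d) = s * norm d" using that by (simp add: dist_norm)
      also have "\<dots> \<le> \<epsilon> * norm d" using that t by (intro mult_right_mono) auto
      finally show ?thesis using y \<epsilon>d \<epsilon>(2) by simp
    qed
    have "g j (y + t *\<^sub>R d) < 0" if j: "j \<in> {1..m}" for j
    proof (cases "j \<in> active m g x")
      case True
      have "g j (y + t *\<^sub>R d) < g j (y + 0 *\<^sub>R d)"
      proof (rule DERIV_neg_imp_decreasing[of 0 t "\<lambda>s. g j (y + s *\<^sub>R d)"])
        show "0 < t" using t by simp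
        fix s assume s: "0 \<le> s" "s \<le> t"
        have "P j (y + s *\<^sub>R d)" using P[OF inb[OF s] True] .
        then show "\<exists>D. ((\<lambda>s. g j (y + s *\<^sub>R d)) has_real_derivative D) (at s) \<and> D < 0"
          unfolding P_def using DERIV_along_line by blast
      qed
      also have "\<dots> \<le> 0" using y j by (simp add: feasible_set_def)
      finally show ?thesis .
    qed (use inact[OF inb[of t]] t j in auto)
    then show "y + t *\<^sub>R d \<in> interior (feasible_set U m g)"
      using U[OF inb[of t]] t by (intro strictly_feasible_in_interior[OF assms(1) cont]) auto
  qed
qed

lemma tangent_direction_in_lin_cone:
  assumes "\<forall>i\<in>{1..m}. C11_submersion_on_zero_set U (g i)" "x \<in> feasible_set U m g"
    and v: "\<And>k. x + v k \<in> feasible_set U m g" "\<And>k. v k \<noteq> 0" "v \<longlonglongrightarrow> 0"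
      "(\<lambda>k. v k /\<^sub>R norm (v k)) \<longlonglongrightarrow> w"
  shows "w \<in> lin_cone m g x"
  unfolding lin_cone_def
proof (intro CollectI ballI)
  fix j assume j: "j \<in> active m g x"
  obtain der: "(g j has_derivative blinfun_apply (fderiv (g j) x)) (at x)" and jm: "j \<in> {1..m}" "g j x = 0"
    using activeE[OF assms(1,2) j] by blast
  have "g j (x + v k) \<le> 0" for k using v(1)[of k] jm by (simp add: feasible_set_def)
  then show "fderiv (g j) x w \<le> 0" by (rule derivative_on_tangent_direction[OF der jm(2) _ v(2-4)])
qed

lemma functional_neg_on_interior:
  fixes F :: "'a::real_normed_vector \<Rightarrow>\<^sub>L real"
  assumes "F \<noteq> 0" "d \<in> interior T" "\<And>h. h \<in> T \<Longrightarrow> F h \<le> 0"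
  shows "F d < 0"
proof -
  obtain w where "F w \<noteq> 0" using assms(1) by (metis blinfun_eqI zero_blinfun.rep_eq)
  then obtain w where w: "F w > 0"
    by (metis blinfun.minus_right linorder_neqE_linordered_idom neg_0_less_iff_less)
  obtain \<epsilon> where \<epsilon>: "\<epsilon> > 0" "ball d \<epsilon> \<subseteq> T"
    using assms(2) by (meson mem_interior)
  have w0: "w \<noteq> 0" using w by auto
  define t where "t = \<epsilon> / (2 * norm w)"
  have t: "t > 0" using \<epsilon> w0 by (simp add: t_def)
  have "d + t *\<^sub>R w \<in> ball d \<epsilon>" using \<epsilon>(1) w0 by (simp add: dist_norm t_def)
  then have "F d + t * F w \<le> 0" using assms(3) \<epsilon>(2) by (force simp: blinfun.add_right blinfun.scaleR_right)
  moreover have "t * F w > 0" using t w by simp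
  ultimately show ?thesis by linarith
qed

lemma supported_at_feasible_set:
  fixes x :: "'a::euclidean_space"
  assumes "\<forall>i\<in>{1..m}. C11_submersion_on_zero_set U (g i)" "x \<in> feasible_set U m g" "i \<in> active m g x"
    and curv: "\<forall>h\<in>lin_cone m g x \<inter> ker (fderiv (g i) x). curvature_ineq r (g i) x h"
    and r: "0 < r" "r < R"
  obtains \<nu> \<delta> where "norm \<nu> = 1" "\<delta> > 0" "feasible_set U m g \<inter> ball x \<delta> \<subseteq> cball (x - R *\<^sub>R \<nu>) R"
    "\<And>h. fderiv (g i) x h = norm (fderiv (g i) x) * (\<nu> \<bullet> h)" "fderiv (g i) x \<noteq> 0"
proof -
  obtain \<delta> L where \<delta>: "\<delta> > 0" "lipschitz_derivative_on L (ball x \<delta>) (g i)" "fderiv (g i) x \<noteq> 0"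
    and i: "i \<in> {1..m}" "g i x = 0"
    using activeE[OF assms(1-3)] by blast
  have "\<exists>\<nu> \<delta>. norm \<nu> = 1 \<and> \<delta> > 0 \<and> feasible_set U m g \<inter> ball x \<delta> \<subseteq> cball (x - R *\<^sub>R \<nu>) R \<and>
            (\<forall>h. fderiv (g i) x h = norm (fderiv (g i) x) * (\<nu> \<bullet> h))"
  proof (rule supported_at_if_curvature_ineq[OF \<delta>(2,1) i(2) \<delta>(3) _ _ _ r])
    show "g i y \<le> 0" if "y \<in> feasible_set U m g" for y using that i by (simp add: feasible_set_def)
    show "curvature_ineq r (g i) x h" if "h \<in> lin_cone m g x" "fderiv (g i) x h = 0" for h
      using curv that by (simp add: ker_def)
  qed (rule tangent_direction_in_lin_cone[OF assms(1,2)])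
  then show ?thesis using that \<delta>(3) by blast
qed

lemma r_convex_feasible_set:
  fixes U :: "'a::euclidean_space set"
  assumes dim: "DIM('a) \<ge> 2" and r: "r > 0" and "open U"
    and g: "\<forall>i\<in>{1..m}. continuous_on U (g i) \<and> C11_submersion_on_zero_set U (g i)"
    and \<Omega>: "\<Omega> = feasible_set U m g" "closed \<Omega>" "connected \<Omega>"
    and d: "\<And>x. x \<in> frontier \<Omega> \<Longrightarrow> \<exists>d. \<forall>j\<in>active m g x. fderiv (g j) x d < 0"
    and curv: "\<And>x. x \<in> frontier \<Omega> \<Longrightarrow>
      \<exists>i\<in>active m g x. \<forall>h\<in>lin_cone m g x \<inter> ker (fderiv (g i) x). curvature_ineq r (g i) x h"
  shows "r_convex r \<Omega>"
proof -
  have fr: "x \<in> \<Omega>" if "x \<in> frontier \<Omega>" for x using that \<Omega>(2) frontier_subset_closed by blast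
  have inw: "inward_at \<Omega> x" if "x \<in> frontier \<Omega>" for x
    using d[OF that] fr[OF that] inward_at_feasible_set[OF assms(3) g] unfolding \<Omega>(1) by blast
  have "supported_at R \<Omega> x" if x: "x \<in> frontier \<Omega>" and R: "R > r" for x R
  proof -
    obtain i where i: "i \<in> active m g x"
      "\<forall>h\<in>lin_cone m g x \<inter> ker (fderiv (g i) x). curvature_ineq r (g i) x h" using curv[OF x] by blast
    have g': "\<forall>i\<in>{1..m}. C11_submersion_on_zero_set U (g i)" using g by simp
    show ?thesis
      using supported_at_feasible_set[OF g' _ i r R] fr[OF x] unfolding supported_at_def \<Omega>(1) by metis
  qed
  then show ?thesis
    using connected_interior_if_inward[OF \<Omega>(2,3) inw]
    by (intro r_convex_if_locally_supported[OF dim r \<Omega>(2)]) auto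
qed

lemma isolated_point_of_connected:
  fixes S :: "'a::metric_space set"
  assumes "connected S" "x \<in> S" "\<delta> > 0" "S \<inter> ball x \<delta> \<subseteq> {x}"
  shows "S = {x}"
proof (rule ccontr)
  assume "S \<noteq> {x}"
  then obtain y where y: "y \<in> S" "y \<noteq> x" using assms(2) by blast
  have "ball x \<delta> \<inter> - {x} \<inter> S = {}" using assms(4) by blast
  moreover have "S \<subseteq> ball x \<delta> \<union> - {x}" using assms(3) by auto
  ultimately show False
    using connectedD[OF assms(1) open_ball[of x \<delta>], of "- {x}"] y assms(2,3) by auto
qed

text \<open>The direction \<open>k\<close> is tangent to the \<open>i\<close>-th constraint and strictly decreasing for the other
  active ones. Along \<open>h + \<epsilon> k\<close> only the \<open>i\<close>-th constraint is felt, so that its zeros close to this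
  direction are feasible.\<close>

lemma curvature_ineq_at_independent_constraints:
  fixes U :: "'a::euclidean_space set"
  assumes r: "r > 0" and "open U"
    and g: "\<forall>i\<in>{1..m}. continuous_on U (g i) \<and> C11_submersion_on_zero_set U (g i)"
    and S: "r_convex r (feasible_set U m g)" and x: "x \<in> feasible_set U m g"
    and indep: "lin_indep_family (active m g x) (\<lambda>i. fderiv (g i) x)"
    and i: "i \<in> active m g x" and h: "h \<in> lin_cone m g x" "fderiv (g i) x h = 0"
  shows "curvature_ineq r (g i) x h"
proof -
  have fin: "finite (active m g x)" by (simp add: active_def)
  have sub: "\<forall>i\<in>{1..m}. C11_submersion_on_zero_set U (g i)" using g by simp
  obtain \<delta> L where \<delta>: "\<delta> > 0" "lipschitz_derivative_on L (ball x \<delta>) (g i)" "fderiv (g i) x \<noteq> 0"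
    and im: "i \<in> {1..m}" "g i x = 0"
    using activeE[OF sub x i] by blast
  obtain k where k: "\<And>j. j \<in> active m g x \<Longrightarrow> fderiv (g j) x k = (if j = i then 0 else -1)"
    using lin_indep_family_solve[OF fin indep, of "\<lambda>j. if j = i then 0 else -1"] by blast
  show ?thesis
  proof (rule curvature_ineq_limit[OF \<delta>(2,1) h(2)])
    show "fderiv (g i) x k = 0" using k[OF i] by simp
    fix \<epsilon> :: real assume \<epsilon>: "0 < \<epsilon>"
    define w0 where "w0 = h + \<epsilon> *\<^sub>R k"
    have Fw: "fderiv (g j) x w0 = fderiv (g j) x h + \<epsilon> * fderiv (g j) x k" for j
      by (simp add: w0_def blinfun.add_right blinfun.scaleR_right)
    have Fi: "fderiv (g i) x w0 = 0" using k[OF i] h(2) by (simp add: Fw)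
    have Fj: "fderiv (g j) x w0 < 0" if "j \<in> active m g x" "j \<noteq> i" for j
      using k[OF that(1)] that h(1) \<epsilon> by (force simp: Fw lin_cone_def)
    define Q where "Q j e \<longleftrightarrow> (\<forall>t w. 0 < t \<and> t < e \<and> norm (w - w0) < e \<longrightarrow> g j (x + t *\<^sub>R w) < 0)"
      for j e
    have "eventually (Q j) (at_right 0)" if j: "j \<in> active m g x - {i}" for j
    proof -
      obtain der: "(g j has_derivative blinfun_apply (fderiv (g j) x)) (at x)" and jm: "g j x = 0"
        using activeE[OF sub x] j by blast
      from negative_on_cone[OF der jm Fj]
      obtain e where "e > 0" "Q j e" using j unfolding Q_def by blast
      then show ?thesis unfolding eventually_at_right_field
        by (intro exI[of _ e]) (auto simp: Q_def)
    qed
    then have "eventually (\<lambda>e. \<forall>j\<in>active m g x - {i}. Q j e) (at_right 0)"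
      using fin by (intro eventually_ball_finite) auto
    then obtain e1 where e1: "e1 > 0" "\<And>e. 0 < e \<Longrightarrow> e < e1 \<Longrightarrow> \<forall>j\<in>active m g x - {i}. Q j e"
      by (auto simp: eventually_at_right_field)
    have "eventually (\<lambda>y. y \<in> U \<and> (\<forall>j\<in>{1..m} - active m g x. g j y < 0)) (nhds x)"
      using g by (intro eventually_inactive_negative[OF assms(2) _ x]) auto
    then obtain e2 where e2: "e2 > 0"
      "\<And>y. dist y x < e2 \<Longrightarrow> y \<in> U \<and> (\<forall>j\<in>{1..m} - active m g x. g j y < 0)"
      unfolding eventually_nhds_metric by blast
    define M where "M = norm w0 + 1"
    have M: "M > 0" by (simp add: M_def add_nonneg_pos)
    define \<eta> where "\<eta> = min (min (e1 / 2) 1) (e2 / M)"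
    have \<eta>: "\<eta> > 0" "\<eta> < e1" using e1(1) e2(1) M by (auto simp: \<eta>_def min_less_iff_disj)
    have "curvature_ineq r (g i) x w0"
    proof (rule curvature_ineq_if_r_convex[OF r S x im(2) \<delta>(2,1,3) _ Fi \<eta>(1)])
      show "g i y \<le> 0" if "y \<in> feasible_set U m g" for y using that im by (simp add: feasible_set_def)
      fix t w assume t: "0 < t" "t < \<eta>" and w: "norm (w - w0) < \<eta>" and gi: "g i (x + t *\<^sub>R w) = 0"
      have act: "g j (x + t *\<^sub>R w) < 0" if "j \<in> active m g x - {i}" for j
        using e1(2)[OF \<eta>] that t w unfolding Q_def by blast
      have "norm (w - w0) < 1" using w by (simp add: \<eta>_def)
      then have "norm w \<le> M" using norm_triangle_ineq2[of w w0] by (simp add: M_def)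
      then have "t * norm w \<le> t * M" using t by (intro mult_left_mono) auto
      also have "\<dots> < e2" using t M by (simp add: \<eta>_def field_simps)
      finally have "dist (x + t *\<^sub>R w) x < e2" using t by (simp add: dist_norm)
      then have in2: "x + t *\<^sub>R w \<in> U" "\<And>j. j \<in> {1..m} - active m g x \<Longrightarrow> g j (x + t *\<^sub>R w) < 0"
        using e2(2) by auto
      have "g j (x + t *\<^sub>R w) \<le> 0" if "j \<in> {1..m}" for j
        using act[of j] in2(2)[of j] gi that by (cases "j = i"; cases "j \<in> active m g x") auto
      then show "x + t *\<^sub>R w \<in> feasible_set U m g" using in2(1) by (simp add: feasible_set_def)
    qed
    then show "curvature_ineq r (g i) x (h + \<epsilon> *\<^sub>R k)" by (simp add: w0_def)
  qed
qed

theorem theorem3p2: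
  fixes r :: real and U :: "(real ^ 'n) set" and m :: nat
    and g :: "nat \<Rightarrow> real ^ 'n \<Rightarrow> real" and \<Omega> :: "(real ^ 'n) set"
  assumes "r > 0"
    and "open U"
    and "m \<ge> 1"
    and "\<forall>i\<in>{1..m}. continuous_on U (g i) \<and> C11_submersion_on_zero_set U (g i)"
    and "\<Omega> = feasible_set U m g"
    and "closed \<Omega>"
    and "connected \<Omega>"
  shows "(CARD('n) \<ge> 2 \<longrightarrow>
           (\<forall>x\<in>frontier \<Omega>. interior (lin_cone m g x) \<noteq> {} \<and>
              (\<exists>i\<in>active m g x. \<forall>h\<in>lin_cone m g x \<inter> ker (fderiv (g i) x).
                 curvature_ineq r (g i) x h)) \<longrightarrow>
           r_convex r \<Omega>) \<and>
         (CARD('n) \<ge> 2 \<longrightarrow>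
           (\<forall>x\<in>frontier \<Omega>. \<forall>i\<in>active m g x.
              \<forall>h\<in>lin_cone m g x \<inter> ker (fderiv (g i) x). curvature_ineq r (g i) x h) \<longrightarrow>
           r_convex r \<Omega>) \<and>
         (r_convex r \<Omega> \<longrightarrow>
           (\<forall>x\<in>frontier \<Omega>. lin_indep_family (active m g x) (\<lambda>i. fderiv (g i) x) \<longrightarrow>
              (\<forall>i\<in>active m g x. \<forall>h\<in>lin_cone m g x \<inter> ker (fderiv (g i) x).
                 curvature_ineq r (g i) x h)))"
proof (intro conjI impI)
  have fr: "x \<in> feasible_set U m g" if "x \<in> frontier \<Omega>" for x
    using that assms(5,6) frontier_subset_closed by blast
  have g': "\<forall>i\<in>{1..m}. C11_submersion_on_zero_set U (g i)" using assms(4) by simp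
  note main = r_convex_feasible_set[OF _ assms(1,2,4-7)]
  {
    assume dim: "CARD('n) \<ge> 2" and *: "\<forall>x\<in>frontier \<Omega>. interior (lin_cone m g x) \<noteq> {} \<and>
      (\<exists>i\<in>active m g x. \<forall>h\<in>lin_cone m g x \<inter> ker (fderiv (g i) x). curvature_ineq r (g i) x h)"
    show "r_convex r \<Omega>"
    proof (rule main)
      show "2 \<le> DIM(real ^ 'n)" using dim by simp
      fix x assume x: "x \<in> frontier \<Omega>"
      then obtain d where d: "d \<in> interior (lin_cone m g x)" using * by blast
      have "fderiv (g j) x d < 0" if j: "j \<in> active m g x" for j
      proof (rule functional_neg_on_interior[OF _ d])
        show "fderiv (g j) x \<noteq> 0" using activeE[OF g' fr[OF x] j] by blast
        show "fderiv (g j) x h \<le> 0" if "h \<in> lin_cone m g x" for h using that j by (simp add: lin_cone_def)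
      qed
      then show "\<exists>d. \<forall>j\<in>active m g x. fderiv (g j) x d < 0" by blast
    qed (use * in blast)
  }
  {
    assume dim: "CARD('n) \<ge> 2" and *: "\<forall>x\<in>frontier \<Omega>. \<forall>i\<in>active m g x.
      \<forall>h\<in>lin_cone m g x \<inter> ker (fderiv (g i) x). curvature_ineq r (g i) x h"
    show "r_convex r \<Omega>"
    proof (cases "\<exists>x\<in>frontier \<Omega>. \<exists>\<delta>>0. \<Omega> \<inter> ball x \<delta> \<subseteq> {x}")
      case True
      then obtain x \<delta> where x: "x \<in> frontier \<Omega>" "\<delta> > 0" "\<Omega> \<inter> ball x \<delta> \<subseteq> {x}" by blast
      then have "\<Omega> = {x}"
        using isolated_point_of_connected[OF assms(7)] fr assms(5) by blast
      then show ?thesis using r_convex_singleton assms(1) by blast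
    next
      case no_isolated: False
      show ?thesis
      proof (rule main)
        show "2 \<le> DIM(real ^ 'n)" using dim by simp
        fix x assume x: "x \<in> frontier \<Omega>"
        have fin: "finite (active m g x)" by (simp add: active_def)
        have r1: "0 \<le> r + 1" using assms(1) by simp
        have "eventually (\<lambda>y. y \<in> \<Omega> - {x} \<longrightarrow> fderiv (g i) x (y - x) < 0) (nhds x)"
          if i: "i \<in> active m g x" for i
        proof -
          \<comment> \<open>any radius above \<open>r\<close> serves\<close>
          obtain \<nu> \<delta> where \<nu>: "norm \<nu> = 1" "\<delta> > 0" "\<Omega> \<inter> ball x \<delta> \<subseteq> cball (x - (r + 1) *\<^sub>R \<nu>) (r + 1)"
            "\<And>h. fderiv (g i) x h = norm (fderiv (g i) x) * (\<nu> \<bullet> h)" "fderiv (g i) x \<noteq> 0"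
            using supported_at_feasible_set[OF g' fr[OF x] i, of r "r + 1"] * x i assms(1)
            unfolding assms(5) by (metis less_add_one)
          have "eventually (\<lambda>y. y \<in> ball x \<delta>) (nhds x)"
            using \<nu>(2) by (intro eventually_nhds_in_open) auto
          then show ?thesis
          proof eventually_elim
            case (elim y)
            show ?case
            proof
              assume y: "y \<in> \<Omega> - {x}"
              then have "x + (y - x) \<in> cball (x - (r + 1) *\<^sub>R \<nu>) (r + 1)" using elim \<nu>(3) by auto
              then have "(norm (y - x))\<^sup>2 + 2 * (r + 1) * (\<nu> \<bullet> (y - x)) \<le> 0"
                by (rule mem_tangent_cball_iff[OF \<nu>(1) r1, THEN iffD1])
              moreover have "(norm (y - x))\<^sup>2 > 0" using y by simp
              ultimately have "2 * (r + 1) * (\<nu> \<bullet> (y - x)) < 0" by linarith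
              then have "\<nu> \<bullet> (y - x) < 0" using assms(1) by (simp add: mult_less_0_iff)
              then show "fderiv (g i) x (y - x) < 0" using \<nu>(4,5) by (simp add: mult_less_0_iff)
            qed
          qed
        qed
        then have "eventually (\<lambda>y. \<forall>i\<in>active m g x. y \<in> \<Omega> - {x} \<longrightarrow> fderiv (g i) x (y - x) < 0) (nhds x)"
          using fin by (intro eventually_ball_finite) auto
        then obtain \<delta> where \<delta>: "\<delta> > 0" "\<And>y i. dist y x < \<delta> \<Longrightarrow> i \<in> active m g x \<Longrightarrow>
            y \<in> \<Omega> - {x} \<Longrightarrow> fderiv (g i) x (y - x) < 0"
          unfolding eventually_nhds_metric by blast
        have "\<not> \<Omega> \<inter> ball x \<delta> \<subseteq> {x}" using no_isolated x \<delta>(1) by blast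
        then obtain y where "y \<in> \<Omega> - {x}" "y \<in> ball x \<delta>" by blast
        then have "y \<in> \<Omega> - {x}" "dist y x < \<delta>" by (simp_all add: dist_commute)
        then show "\<exists>d. \<forall>j\<in>active m g x. fderiv (g j) x d < 0" using \<delta>(2) by blast
        have "active m g x \<noteq> {}"
          using active_nonempty_at_frontier[OF assms(2) _ fr[OF x]] x assms(4,5) by blast
        then show "\<exists>i\<in>active m g x. \<forall>h\<in>lin_cone m g x \<inter> ker (fderiv (g i) x). curvature_ineq r (g i) x h"
          using * x by blast
      qed
    qed
  }
  {
    assume "r_convex r \<Omega>"
    then show "\<forall>x\<in>frontier \<Omega>. lin_indep_family (active m g x) (\<lambda>i. fderiv (g i) x) \<longrightarrow>
        (\<forall>i\<in>active m g x. \<forall>h\<in>lin_cone m g x \<inter> ker (fderiv (g i) x). curvature_ineq r (g i) x h)"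
      using curvature_ineq_at_independent_constraints[OF assms(1,2,4)] fr
      unfolding assms(5) ker_def by blast
  }
qed

end
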